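(* Let $(M^n,\phi,\xi,\eta,g)$ be an $n$-dimensional para-Sasakian manifold, equipped with the quarter-symmetric metric connection $\tilde\nabla_X Y=\nabla_X Y+\eta(Y)\phi X-g(\phi X,Y)\xi$, where $\nabla$ is the Levi-Civita connection of $g$. Let $\tilde R$ and $\tilde S$ be the curvature tensor and Ricci tensor of $\tilde\nabla$, and let $$\tilde P(X,Y)Z=\tilde R(X,Y)Z-\frac{1}{n-1}[\tilde S(Y,Z)X-\tilde S(X,Z)Y]$$ be its projective curvature tensor. Suppose that $M^n$ is projectively pseudosymmetric with respect to $\tilde\nabla$, i.e. there is a function $L_{\tilde P}$ on $U_{\tilde P}=\{x\in M^n:\tilde P\neq0\text{ at }x\}$ such that $$\tilde R(X,Y)\cdot\tilde P=L_{\tilde P}\,[(X\wedge_gY)\cdot\tilde P]$$ holds on $U_{\tilde P}$ for all vector fields $X,Y$. Then $M^n$ is an Einstein manifold with respect to $\tilde\nabla$, or $L_{\tilde P}=-2$.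
   Context: Para-Sasakian manifold: a differentiable manifold $M^n$ with a $(1,1)$-tensor field $\phi$, a vector field $\xi$, a 1-form $\eta$ and a Riemannian metric $g$ such that, for all vector fields $X,Y$: $\phi^2X=X-\eta(X)\xi$, $\eta(\xi)=1$, $\phi\xi=0$, $\eta(\phi X)=0$, $g(X,\xi)=\eta(X)$, $g(\phi X,\phi Y)=g(X,Y)-\eta(X)\eta(Y)$, and moreover $(\nabla_X\phi)Y=-g(X,Y)\xi-\eta(Y)X+2\eta(X)\eta(Y)\xi$, $d\eta=0$, $\nabla_X\xi=\phi X$, with $\nabla$ the Levi-Civita connection of $g$. (Here $n>1$, so that $\tilde P$ is defined.) Curvature: $\tilde R(X,Y)Z=\tilde\nabla_X\tilde\nabla_YZ-\tilde\nabla_Y\tilde\nabla_XZ-\tilde\nabla_{[X,Y]}Z$. Ricci tensor: $\tilde S(Y,Z)=\mathrm{trace}\{X\mapsto\tilde R(X,Y)Z\}$. $(X\wedge_gY)$ is the endomorphism $(X\wedge_gY)Z=g(Y,Z)X-g(X,Z)Y$. For an endomorphism $A$ (here $A=\tilde R(X,Y)$ or $A=X\wedge_gY$) acting as a derivation on a $(1,3)$-tensor $T$: $(A\cdot T)(U,V)W=A(T(U,V)W)-T(AU,V)W-T(U,AV)W-T(U,V)AW$. $M^n$ is Einstein with respect to $\tilde\nabla$ if $\tilde S$ is a constant multiple of $g$. *)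

theory Defs
  imports "HOL-Analysis.Analysis" "HOL-Library.Function_Algebras"
begin

text \<open>
  Functions carry the pointwise ring structure of \<^theory>\<open>HOL-Library.Function_Algebras\<close>; with the
  pointwise scalar multiplication they also form a real vector space, so that tangent spaces are
  real subspaces in the sense of the library.
\<close>

instantiation "fun" :: (type, scaleR) scaleR
begin

definition scaleR_fun :: "real \<Rightarrow> ('a \<Rightarrow> 'b) \<Rightarrow> 'a \<Rightarrow> 'b"
  where "scaleR_fun r f = (\<lambda>x. r *\<^sub>R f x)"

instance ..

end

instance "fun" :: (type, real_vector) real_vector
  by standard (auto simp: scaleR_fun_def plus_fun_def scaleR_add_right scaleR_add_left)

definition linear_on :: "'a::real_vector set \<Rightarrow> ('a \<Rightarrow> 'b::real_vector) \<Rightarrow> bool"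
  where "linear_on V T \<longleftrightarrow>
    (\<forall>u\<in>V. \<forall>v\<in>V. T (u + v) = T u + T v) \<and> (\<forall>a. \<forall>u\<in>V. T (a *\<^sub>R u) = a *\<^sub>R T u)"

text \<open>
  The trace of an endomorphism of a finite-dimensional subspace, computed in some basis.
\<close>

definition trace_on :: "'a::real_vector set \<Rightarrow> ('a \<Rightarrow> 'a) \<Rightarrow> real"
  where "trace_on V T =
    (let B = (SOME B. B \<subseteq> V \<and> independent B \<and> V \<subseteq> span B)
     in \<Sum>b\<in>B. representation B (T b) b)"


section \<open>Smooth manifolds\<close>

text \<open>The following two notions are meant for open sets \<open>S\<close> only.\<close>

primrec Ck_on :: "nat \<Rightarrow> 'a::euclidean_space set \<Rightarrow> ('a \<Rightarrow> 'b::real_normed_vector) \<Rightarrow> bool"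
  where
    "Ck_on 0 S f \<longleftrightarrow> continuous_on S f"
  | "Ck_on (Suc k) S f \<longleftrightarrow>
      (\<forall>x\<in>S. f differentiable (at x)) \<and> (\<forall>v. Ck_on k S (\<lambda>x. frechet_derivative f (at x) v))"

definition smooth_on :: "'a::euclidean_space set \<Rightarrow> ('a \<Rightarrow> 'b::real_normed_vector) \<Rightarrow> bool"
  where "smooth_on S f \<longleftrightarrow> (\<forall>k. Ck_on k S f)"

text \<open>
  A manifold is a whole Hausdorff, second countable type \<open>'m\<close> with a smooth atlas; its dimension
  is \<open>CARD('n)\<close>. A chart is a domain together with a coordinate map.  The atlas is not required to
  be maximal; an atlas and its maximal extension have the same smooth functions.
\<close>

type_synonym ('m, 'n) atlas = "('m set \<times> ('m \<Rightarrow> real ^ 'n)) set"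

definition smooth_atlas ::
    "('m::{t2_space, second_countable_topology}, 'n::finite) atlas \<Rightarrow> bool"
  where "smooth_atlas \<A> \<longleftrightarrow>
    (\<forall>(U, c) \<in> \<A>. open U \<and> open (c ` U) \<and> homeomorphism U (c ` U) c (inv_into U c)) \<and>
    (\<Union>(U, c) \<in> \<A>. U) = UNIV \<and>
    (\<forall>(U, c) \<in> \<A>. \<forall>(V, d) \<in> \<A>. smooth_on (c ` (U \<inter> V)) (d \<circ> inv_into U c))"

definition smooth_functions :: "('m, 'n::finite) atlas \<Rightarrow> ('m \<Rightarrow> real) set"
  where "smooth_functions \<A> = {f. \<forall>(U, c) \<in> \<A>. smooth_on (c ` U) (f \<circ> inv_into U c)}"

text \<open>
  A tangent vector at \<open>p\<close> is a derivation at \<open>p\<close> of the algebra of smooth functions. The last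
  clause fixes its values on non-smooth functions, so that equal derivations are equal as
  HOL functions.
\<close>

type_synonym 'm tvec = "('m \<Rightarrow> real) \<Rightarrow> real"

type_synonym 'm vfield = "'m \<Rightarrow> 'm tvec"

definition tangent_space :: "('m, 'n::finite) atlas \<Rightarrow> 'm \<Rightarrow> 'm tvec set"
  where "tangent_space \<A> p = {v.
    linear_on (smooth_functions \<A>) v \<and>
    (\<forall>f\<in>smooth_functions \<A>. \<forall>h\<in>smooth_functions \<A>. v (f * h) = f p * v h + h p * v f) \<and>
    (\<forall>f. f \<notin> smooth_functions \<A> \<longrightarrow> v f = 0)}"

definition deriv_along :: "'m vfield \<Rightarrow> ('m \<Rightarrow> real) \<Rightarrow> 'm \<Rightarrow> real"
  where "deriv_along X f = (\<lambda>p. X p f)"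

definition vector_fields :: "('m, 'n::finite) atlas \<Rightarrow> 'm vfield set"
  where "vector_fields \<A> = {X.
    (\<forall>p. X p \<in> tangent_space \<A> p) \<and>
    (\<forall>f\<in>smooth_functions \<A>. deriv_along X f \<in> smooth_functions \<A>)}"

definition lie_bracket :: "'m vfield \<Rightarrow> 'm vfield \<Rightarrow> 'm vfield"
  where "lie_bracket X Y = (\<lambda>p f. X p (deriv_along Y f) - Y p (deriv_along X f))"

definition fscale :: "('m \<Rightarrow> real) \<Rightarrow> 'm vfield \<Rightarrow> 'm vfield"  (infixr "\<cdot>" 75)
  where "f \<cdot> X = (\<lambda>p. f p *\<^sub>R X p)"

text \<open>
  Pointwise application of a field of maps: \<open>\<phi> \<diamondop> X\<close> is the field \<open>\<phi> X\<close>, and \<open>g \<diamondop> X \<diamondop> Y\<close> is the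
  function \<open>g(X, Y)\<close>.
\<close>

definition field_app :: "('m \<Rightarrow> 'a \<Rightarrow> 'b) \<Rightarrow> ('m \<Rightarrow> 'a) \<Rightarrow> 'm \<Rightarrow> 'b"  (infixl "\<diamondop>" 90)
  where "T \<diamondop> X = (\<lambda>p. T p (X p))"

definition one_form :: "('m, 'n::finite) atlas \<Rightarrow> ('m \<Rightarrow> 'm tvec \<Rightarrow> real) \<Rightarrow> bool"
  where "one_form \<A> \<eta> \<longleftrightarrow>
    (\<forall>p. linear_on (tangent_space \<A> p) (\<eta> p)) \<and>
    (\<forall>X\<in>vector_fields \<A>. \<eta> \<diamondop> X \<in> smooth_functions \<A>)"

definition endomorphism_field ::
    "('m, 'n::finite) atlas \<Rightarrow> ('m \<Rightarrow> 'm tvec \<Rightarrow> 'm tvec) \<Rightarrow> bool"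
  where "endomorphism_field \<A> \<phi> \<longleftrightarrow>
    (\<forall>p. linear_on (tangent_space \<A> p) (\<phi> p) \<and>
         \<phi> p ` tangent_space \<A> p \<subseteq> tangent_space \<A> p) \<and>
    (\<forall>X\<in>vector_fields \<A>. \<phi> \<diamondop> X \<in> vector_fields \<A>)"

definition riemannian_metric ::
    "('m, 'n::finite) atlas \<Rightarrow> ('m \<Rightarrow> 'm tvec \<Rightarrow> 'm tvec \<Rightarrow> real) \<Rightarrow> bool"
  where "riemannian_metric \<A> g \<longleftrightarrow>
    (\<forall>p. \<forall>u\<in>tangent_space \<A> p.
        linear_on (tangent_space \<A> p) (g p u) \<and>
        (\<forall>v\<in>tangent_space \<A> p. g p u v = g p v u) \<and>
        (u \<noteq> 0 \<longrightarrow> g p u u > 0)) \<and>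
    (\<forall>X\<in>vector_fields \<A>. \<forall>Y\<in>vector_fields \<A>. g \<diamondop> X \<diamondop> Y \<in> smooth_functions \<A>)"


section \<open>Connections and curvature\<close>

definition affine_connection ::
    "('m, 'n::finite) atlas \<Rightarrow> ('m vfield \<Rightarrow> 'm vfield \<Rightarrow> 'm vfield) \<Rightarrow> bool"
  where "affine_connection \<A> D \<longleftrightarrow>
    (\<forall>X\<in>vector_fields \<A>. \<forall>Y\<in>vector_fields \<A>.
        D X Y \<in> vector_fields \<A> \<and>
        (\<forall>Z\<in>vector_fields \<A>. D (X + Y) Z = D X Z + D Y Z \<and> D X (Y + Z) = D X Y + D X Z) \<and>
        (\<forall>f\<in>smooth_functions \<A>.
            D (f \<cdot> X) Y = f \<cdot> D X Y \<and> D X (f \<cdot> Y) = deriv_along X f \<cdot> Y + f \<cdot> D X Y))"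

definition levi_civita ::
    "('m, 'n::finite) atlas \<Rightarrow> ('m \<Rightarrow> 'm tvec \<Rightarrow> 'm tvec \<Rightarrow> real) \<Rightarrow>
      ('m vfield \<Rightarrow> 'm vfield \<Rightarrow> 'm vfield) \<Rightarrow> bool"
  where "levi_civita \<A> g D \<longleftrightarrow>
    affine_connection \<A> D \<and>
    (\<forall>X\<in>vector_fields \<A>. \<forall>Y\<in>vector_fields \<A>. D X Y - D Y X = lie_bracket X Y) \<and>
    (\<forall>X\<in>vector_fields \<A>. \<forall>Y\<in>vector_fields \<A>. \<forall>Z\<in>vector_fields \<A>.
        deriv_along X (g \<diamondop> Y \<diamondop> Z) = g \<diamondop> D X Y \<diamondop> Z + g \<diamondop> Y \<diamondop> D X Z)"

definition curvature ::
    "('m vfield \<Rightarrow> 'm vfield \<Rightarrow> 'm vfield) \<Rightarrow> 'm vfield \<Rightarrow> 'm vfield \<Rightarrow> 'm vfield \<Rightarrow> 'm vfield"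
  where "curvature D X Y Z = D X (D Y Z) - D Y (D X Z) - D (lie_bracket X Y) Z"

text \<open>
  For a connection, the value of \<open>curvature D V Y Z\<close> at \<open>p\<close> depends on \<open>V\<close> only through \<open>V p\<close>, so
  the choice of the vector field extending the tangent vector \<open>v\<close> is immaterial.
\<close>

definition ricci ::
    "('m, 'n::finite) atlas \<Rightarrow> ('m vfield \<Rightarrow> 'm vfield \<Rightarrow> 'm vfield) \<Rightarrow>
      'm vfield \<Rightarrow> 'm vfield \<Rightarrow> 'm \<Rightarrow> real"
  where "ricci \<A> D Y Z = (\<lambda>p. trace_on (tangent_space \<A> p)
    (\<lambda>v. curvature D (SOME V. V \<in> vector_fields \<A> \<and> V p = v) Y Z p))"

definition projective_curvature ::
    "('m, 'n::finite) atlas \<Rightarrow> ('m vfield \<Rightarrow> 'm vfield \<Rightarrow> 'm vfield) \<Rightarrow>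
      'm vfield \<Rightarrow> 'm vfield \<Rightarrow> 'm vfield \<Rightarrow> 'm vfield"
  where "projective_curvature \<A> D X Y Z = curvature D X Y Z -
    (1 / (real CARD('n) - 1)) *\<^sub>R (ricci \<A> D Y Z \<cdot> X - ricci \<A> D X Z \<cdot> Y)"

definition einstein ::
    "('m, 'n::finite) atlas \<Rightarrow> ('m \<Rightarrow> 'm tvec \<Rightarrow> 'm tvec \<Rightarrow> real) \<Rightarrow>
      ('m vfield \<Rightarrow> 'm vfield \<Rightarrow> 'm vfield) \<Rightarrow> bool"
  where "einstein \<A> g D \<longleftrightarrow>
    (\<exists>a::real. \<forall>Y\<in>vector_fields \<A>. \<forall>Z\<in>vector_fields \<A>. ricci \<A> D Y Z = a *\<^sub>R (g \<diamondop> Y \<diamondop> Z))"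

definition wedge ::
    "('m \<Rightarrow> 'm tvec \<Rightarrow> 'm tvec \<Rightarrow> real) \<Rightarrow> 'm vfield \<Rightarrow> 'm vfield \<Rightarrow> 'm vfield \<Rightarrow> 'm vfield"
  where "wedge g X Y Z = (g \<diamondop> Y \<diamondop> Z) \<cdot> X - (g \<diamondop> X \<diamondop> Z) \<cdot> Y"

definition derivation_act ::
    "('m vfield \<Rightarrow> 'm vfield) \<Rightarrow> ('m vfield \<Rightarrow> 'm vfield \<Rightarrow> 'm vfield \<Rightarrow> 'm vfield) \<Rightarrow>
      'm vfield \<Rightarrow> 'm vfield \<Rightarrow> 'm vfield \<Rightarrow> 'm vfield"
  where "derivation_act A T U V W = A (T U V W) - T (A U) V W - T U (A V) W - T U V (A W)"

definition projective_support ::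
    "('m, 'n::finite) atlas \<Rightarrow> ('m vfield \<Rightarrow> 'm vfield \<Rightarrow> 'm vfield) \<Rightarrow> 'm set"
  where "projective_support \<A> D = {x.
    \<exists>X\<in>vector_fields \<A>. \<exists>Y\<in>vector_fields \<A>. \<exists>Z\<in>vector_fields \<A>.
      projective_curvature \<A> D X Y Z x \<noteq> 0}"

text \<open>Only the values of \<open>L\<close> on the set where the projective curvature is nonzero matter.\<close>

definition projectively_pseudosymmetric ::
    "('m, 'n::finite) atlas \<Rightarrow> ('m \<Rightarrow> 'm tvec \<Rightarrow> 'm tvec \<Rightarrow> real) \<Rightarrow>
      ('m vfield \<Rightarrow> 'm vfield \<Rightarrow> 'm vfield) \<Rightarrow> ('m \<Rightarrow> real) \<Rightarrow> bool"
  where "projectively_pseudosymmetric \<A> g D L \<longleftrightarrow>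
    (\<forall>x\<in>projective_support \<A> D. \<forall>X\<in>vector_fields \<A>. \<forall>Y\<in>vector_fields \<A>.
      \<forall>U\<in>vector_fields \<A>. \<forall>V\<in>vector_fields \<A>. \<forall>W\<in>vector_fields \<A>.
        derivation_act (curvature D X Y) (projective_curvature \<A> D) U V W x =
        L x *\<^sub>R derivation_act (wedge g X Y) (projective_curvature \<A> D) U V W x)"


section \<open>Para-Sasakian manifolds\<close>

definition para_sasakian ::
    "('m::{t2_space, second_countable_topology}, 'n::finite) atlas \<Rightarrow>
      ('m \<Rightarrow> 'm tvec \<Rightarrow> 'm tvec) \<Rightarrow> 'm vfield \<Rightarrow> ('m \<Rightarrow> 'm tvec \<Rightarrow> real) \<Rightarrow>
      ('m \<Rightarrow> 'm tvec \<Rightarrow> 'm tvec \<Rightarrow> real) \<Rightarrow> ('m vfield \<Rightarrow> 'm vfield \<Rightarrow> 'm vfield) \<Rightarrow> bool"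
  where "para_sasakian \<A> \<phi> \<xi> \<eta> g D \<longleftrightarrow>
    smooth_atlas \<A> \<and> endomorphism_field \<A> \<phi> \<and> \<xi> \<in> vector_fields \<A> \<and> one_form \<A> \<eta> \<and>
    riemannian_metric \<A> g \<and> levi_civita \<A> g D \<and>
    \<eta> \<diamondop> \<xi> = 1 \<and> \<phi> \<diamondop> \<xi> = 0 \<and>
    (\<forall>X\<in>vector_fields \<A>.
        \<phi> \<diamondop> (\<phi> \<diamondop> X) = X - (\<eta> \<diamondop> X) \<cdot> \<xi> \<and>
        \<eta> \<diamondop> (\<phi> \<diamondop> X) = 0 \<and>
        g \<diamondop> X \<diamondop> \<xi> = \<eta> \<diamondop> X \<and>
        D X \<xi> = \<phi> \<diamondop> X) \<and>
    (\<forall>X\<in>vector_fields \<A>. \<forall>Y\<in>vector_fields \<A>.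
        g \<diamondop> (\<phi> \<diamondop> X) \<diamondop> (\<phi> \<diamondop> Y) = g \<diamondop> X \<diamondop> Y - (\<eta> \<diamondop> X) * (\<eta> \<diamondop> Y) \<and>
        D X (\<phi> \<diamondop> Y) - \<phi> \<diamondop> D X Y =
          - ((g \<diamondop> X \<diamondop> Y) \<cdot> \<xi>) - (\<eta> \<diamondop> Y) \<cdot> X + 2 *\<^sub>R (((\<eta> \<diamondop> X) * (\<eta> \<diamondop> Y)) \<cdot> \<xi>) \<and>
        deriv_along X (\<eta> \<diamondop> Y) - deriv_along Y (\<eta> \<diamondop> X) - \<eta> \<diamondop> lie_bracket X Y = 0)"

definition quarter_symmetric_connection ::
    "('m \<Rightarrow> 'm tvec \<Rightarrow> 'm tvec) \<Rightarrow> 'm vfield \<Rightarrow> ('m \<Rightarrow> 'm tvec \<Rightarrow> real) \<Rightarrow>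
      ('m \<Rightarrow> 'm tvec \<Rightarrow> 'm tvec \<Rightarrow> real) \<Rightarrow> ('m vfield \<Rightarrow> 'm vfield \<Rightarrow> 'm vfield) \<Rightarrow>
      'm vfield \<Rightarrow> 'm vfield \<Rightarrow> 'm vfield"
  where "quarter_symmetric_connection \<phi> \<xi> \<eta> g D X Y =
    D X Y + (\<eta> \<diamondop> Y) \<cdot> (\<phi> \<diamondop> X) - (g \<diamondop> (\<phi> \<diamondop> X) \<diamondop> Y) \<cdot> \<xi>"

end

theory Submission
  imports Defs
begin

text \<open>
  The second alternative always holds, and the components in the direction of \<open>\<xi>\<close> suffice to see it.
  From \<open>\<nabla>\<^sub>X \<xi> = \<phi> X\<close> one gets \<open>D'\<^sub>X \<xi> = 2 \<phi> X\<close>, hence \<open>R'(X,Y)\<xi> = 2 (\<eta>(X) Y - \<eta>(Y) X)\<close>; taking the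
  trace, \<open>S'(Y,\<xi>) = -2 (n - 1) \<eta>(Y)\<close>, and therefore \<open>P'(U,V)\<xi> = 0\<close>. Evaluating the pseudosymmetry
  condition for the pair \<open>(\<xi>,Y)\<close> on \<open>(U,V,\<xi>)\<close>, only the term in which the derivation hits the last
  argument survives: it gives \<open>-2 P'(U,V)Y = L P'(U,V)Y\<close>.

  Computing the trace requires that the space of derivations at a point has dimension \<open>n\<close> and that
  each derivation extends to a vector field. Both follow from Hadamard's lemma and smooth bump
  functions.
\<close>

section \<open>Calculus of \<open>C\<^sup>k\<close> functions\<close>

text \<open>The constant -2 is a curvature: for all X and Y, \<open>R'(X,Y)\<xi>\<close> is -2 times
  \<open>(X wedge Y)\<xi>\<close>, twice the factor -1 that holds for the Levi-Civita connection. A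
  derivation A therefore acts on P' at (U,V,\<xi>) as \<open>- P'(U,V)(A \<xi>)\<close>, and the
  hypothesis becomes \<open>(L + 2) P'(U,V)((X wedge Y)\<xi>) = 0\<close>. For X = \<xi> the vector
  \<open>(\<xi> wedge Y)\<xi> = \<eta>(Y)\<xi> - Y\<close> is -Y modulo \<xi>, and Y is free, so it
  can be taken from a triple on which P' does not vanish. The analytic half is forced by the trace
  in the Ricci tensor: n has to appear as the size of a basis, and each basis vector is extended to
  a global field. Tangent vectors act on global functions only, whereas coordinates live on a chart;
  every local object is therefore multiplied by a bump and extended by zero before a derivation can
  see it.\<close>

lemma Ck_on_cong:
  assumes "Ck_on k S f" "\<And>x. x \<in> S \<Longrightarrow> f x = g x" "open S"
  shows "Ck_on k S g"
  using assms(1,2)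
proof (induction k arbitrary: f g)
  case 0
  then show ?case by (simp cong: continuous_on_cong)
next
  case (Suc k)
  have d: "(g has_derivative frechet_derivative f (at x)) (at x)" if "x \<in> S" for x
    using has_derivative_transform_within_open[OF _ \<open>open S\<close> that, of f] Suc.prems that
    by (auto simp: frechet_derivative_works)
  have "frechet_derivative f (at x) = frechet_derivative g (at x)" if "x \<in> S" for x
    using frechet_derivative_at[OF d[OF that]] .
  then show ?case
    using d Suc.prems by (auto simp: differentiable_def intro: Suc.IH)
qed

text \<open>\<open>frechet_derivative\<close> is defined by choice; uniqueness of derivatives lets
  any explicit derivative take its place. Most closure properties below go through this
  rule.\<close>

lemma Ck_on_SucI:
  assumes "\<And>x. x \<in> S \<Longrightarrow> (f has_derivative f' x) (at x)"
    and "\<And>v. Ck_on k S (\<lambda>x. f' x v)"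
    and "open S"
  shows "Ck_on (Suc k) S f"
proof -
  have "frechet_derivative f (at x) = f' x" if "x \<in> S" for x
    using assms(1)[OF that] frechet_derivative_at by metis
  then show ?thesis
    using assms(1,3) by (auto simp: differentiable_def intro: Ck_on_cong[OF assms(2)])
qed

lemma Ck_on_Suc_imp: "Ck_on (Suc k) S f \<Longrightarrow> Ck_on k S f"
proof (induction k arbitrary: f)
  case 0
  then show ?case
    by (auto intro!: continuous_at_imp_continuous_on differentiable_imp_continuous_within)
next
  case (Suc k)
  then show ?case by (metis Ck_on.simps(2))
qed

lemma Ck_on_imp_continuous_on: "Ck_on k S f \<Longrightarrow> continuous_on S f"
proof (induction k)
  case (Suc k)
  then show ?case using Ck_on_Suc_imp by blast
qed simp

lemma Ck_on_subset: "Ck_on k S f \<Longrightarrow> T \<subseteq> S \<Longrightarrow> Ck_on k T f"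
  by (induction k arbitrary: f) (auto intro: continuous_on_subset)

text \<open>This is what later glues a function on a manifold from its restrictions to a chart ball
  and to the complement of a compact set.\<close>

lemma Ck_on_locally:
  assumes "\<And>x. x \<in> S \<Longrightarrow> \<exists>T. open T \<and> x \<in> T \<and> Ck_on k T f"
  shows "Ck_on k S f"
  using assms
proof (induction k arbitrary: f)
  case 0
  have "isCont f x" if "x \<in> S" for x
    using 0[OF that] by (auto simp: continuous_on_eq_continuous_at)
  then show ?case by (simp add: continuous_at_imp_continuous_on)
next
  case (Suc k)
  then have "f differentiable at x" if "x \<in> S" for x
    using that by fastforce
  moreover have "Ck_on k S (\<lambda>x. frechet_derivative f (at x) v)" for v
    by (rule Suc.IH) (use Suc.prems in fastforce)
  ultimately show ?case by simp
qed

lemma Ck_on_const: "Ck_on k S (\<lambda>x. c)"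
proof (induction k arbitrary: c)
  case (Suc k)
  then show ?case
    by (simp add: frechet_derivative_const)
qed simp

lemma Ck_on_linear_compose:
  assumes "bounded_linear h" "Ck_on k S f" "open S"
  shows "Ck_on k S (\<lambda>x. h (f x))"
  using assms(2)
proof (induction k arbitrary: f)
  case 0
  then show ?case
    using bounded_linear.continuous_on[OF assms(1)] by auto
next
  case (Suc k)
  show ?case
  proof (rule Ck_on_SucI)
    show "((\<lambda>x. h (f x)) has_derivative (\<lambda>v. h (frechet_derivative f (at x) v))) (at x)"
      if "x \<in> S" for x
      using Suc.prems that bounded_linear.has_derivative[OF assms(1)]
      by (auto simp: frechet_derivative_works)
  qed (use Suc assms in auto)
qed

lemma Ck_on_ident: "open S \<Longrightarrow> Ck_on k S (\<lambda>x. x)"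
  by (cases k) (auto intro!: Ck_on_SucI has_derivative_ident Ck_on_const)

lemma Ck_on_add:
  assumes "Ck_on k S f" "Ck_on k S g" "open S"
  shows "Ck_on k S (\<lambda>x. f x + g x)"
  using assms(1,2)
proof (induction k arbitrary: f g)
  case (Suc k)
  show ?case
  proof (rule Ck_on_SucI)
    show "((\<lambda>x. f x + g x) has_derivative
        (\<lambda>v. frechet_derivative f (at x) v + frechet_derivative g (at x) v)) (at x)"
      if "x \<in> S" for x
      using Suc.prems that by (auto simp: frechet_derivative_works intro: has_derivative_add)
  qed (use Suc assms in auto)
qed (auto intro: continuous_on_add)

lemma Ck_on_sum:
  assumes "\<And>i. i \<in> I \<Longrightarrow> Ck_on k S (f i)" "open S"
  shows "Ck_on k S (\<lambda>x. \<Sum>i\<in>I. f i x)"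
  using assms(1)
  by (induction I rule: infinite_finite_induct) (auto intro: Ck_on_add Ck_on_const assms(2))

lemma Ck_on_scaleR:
  fixes f :: "'a::euclidean_space \<Rightarrow> real" and g :: "'a \<Rightarrow> 'b::real_normed_vector"
  assumes "Ck_on k S f" "Ck_on k S g" "open S"
  shows "Ck_on k S (\<lambda>x. f x *\<^sub>R g x)"
  using assms(1,2)
proof (induction k arbitrary: f g)
  case (Suc k)
  show ?case
  proof (rule Ck_on_SucI)
    show "((\<lambda>x. f x *\<^sub>R g x) has_derivative
        (\<lambda>v. f x *\<^sub>R frechet_derivative g (at x) v + frechet_derivative f (at x) v *\<^sub>R g x)) (at x)"
      if "x \<in> S" for x
      using Suc.prems that by (auto simp: frechet_derivative_works intro: has_derivative_scaleR)
    show "Ck_on k S (\<lambda>x. f x *\<^sub>R frechet_derivative g (at x) v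
        + frechet_derivative f (at x) v *\<^sub>R g x)" for v
      using Suc.prems Ck_on_Suc_imp[OF Suc.prems(1)] Ck_on_Suc_imp[OF Suc.prems(2)] assms(3)
      by (auto intro!: Ck_on_add Suc.IH)
  qed fact
qed (auto intro: continuous_on_scaleR)

lemma Ck_on_mult:
  fixes f g :: "'a::euclidean_space \<Rightarrow> real"
  assumes "Ck_on k S f" "Ck_on k S g" "open S"
  shows "Ck_on k S (\<lambda>x. f x * g x)"
  using Ck_on_scaleR[OF assms] by simp

lemma has_derivative_Basis:
  fixes f :: "'a::euclidean_space \<Rightarrow> 'b::real_normed_vector"
  assumes "(f has_derivative f') (at x)"
  shows "(f has_derivative (\<lambda>v. \<Sum>b\<in>Basis. (v \<bullet> b) *\<^sub>R f' b)) (at x)"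
proof -
  have lin: "linear f'"
    using assms has_derivative_linear by blast
  have "f' v = (\<Sum>b\<in>Basis. (v \<bullet> b) *\<^sub>R f' b)" for v
    using arg_cong[OF euclidean_representation[of v], of f']
    by (simp add: linear_sum[OF lin] linear_scale[OF lin])
  then have "f' = (\<lambda>v. \<Sum>b\<in>Basis. (v \<bullet> b) *\<^sub>R f' b)" by (rule ext)
  then show ?thesis by (rule has_derivative_eq_rhs[OF assms])
qed

text \<open>The chain rule differentiates g in the direction \<open>?f' x v\<close>, which moves
  with x, while \<open>Ck_on\<close> speaks of fixed directions. Expanding the direction in the
  basis leaves scalar functions times derivatives of g in fixed directions, to which the induction
  hypothesis applies.\<close>

lemma Ck_on_compose:
  fixes f :: "'a::euclidean_space \<Rightarrow> 'b::euclidean_space"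
    and g :: "'b \<Rightarrow> 'c::real_normed_vector"
  assumes "Ck_on k S f" "Ck_on k T g" "f ` S \<subseteq> T" "open S"
  shows "Ck_on k S (\<lambda>x. g (f x))"
  using assms(1,2)
proof (induction k arbitrary: g)
  case 0
  then show ?case using continuous_on_compose2[of T g S f] assms(3) by auto
next
  case (Suc k)
  let ?f' = "\<lambda>x. frechet_derivative f (at x)" and ?g' = "\<lambda>x. frechet_derivative g (at x)"
  have f: "(f has_derivative ?f' x) (at x)" and g: "(g has_derivative ?g' (f x)) (at (f x))"
    if "x \<in> S" for x
    using that Suc.prems assms(3) by (auto simp: frechet_derivative_works)
  show ?case
  proof (rule Ck_on_SucI)
    show "((\<lambda>x. g (f x)) has_derivative (\<lambda>v. \<Sum>b\<in>Basis. (?f' x v \<bullet> b) *\<^sub>R ?g' (f x) b)) (at x)"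
      if "x \<in> S" for x
      using has_derivative_compose[OF f[OF that] has_derivative_Basis[OF g[OF that]]] .
    show "Ck_on k S (\<lambda>x. \<Sum>b\<in>Basis. (?f' x v \<bullet> b) *\<^sub>R ?g' (f x) b)" for v
      using Suc.prems Ck_on_Suc_imp[OF Suc.prems(1)] assms(4)
      by (intro Ck_on_sum Ck_on_scaleR Suc.IH Ck_on_linear_compose[OF bounded_linear_inner_left])
        auto
  qed fact
qed

section \<open>Bump functions and Hadamard's lemma\<close>

text \<open>The case m = 0 is the classical smooth function exp(-1/t) that is flat at 0. The powers
  of 1/t close the family under differentiation up to linear combinations, so that one induction
  treats all members at once.\<close>

definition flat :: "nat \<Rightarrow> real \<Rightarrow> real"
  where "flat m t = (if t > 0 then exp (- inverse t) * inverse t ^ m else 0)"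

lemma flat_tendsto_0: "(flat m \<longlongrightarrow> 0) (at 0)"
proof -
  have "((\<lambda>t. inverse t ^ m / exp (inverse t)) \<longlongrightarrow> (0::real)) (at_right 0)"
    using filterlim_compose[OF tendsto_power_div_exp_0 filterlim_inverse_at_top_right] .
  moreover have "\<forall>\<^sub>F t in at_right 0. inverse t ^ m / exp (inverse t) = flat m t"
    by (auto simp: eventually_at_filter flat_def exp_minus divide_inverse mult.commute)
  ultimately have "(flat m \<longlongrightarrow> 0) (at_right 0)"
    by (rule Lim_transform_eventually)
  moreover have "(flat m \<longlongrightarrow> 0) (at_left 0)"
    by (rule Lim_transform_eventually[OF tendsto_const])
      (auto simp: eventually_at_filter flat_def)
  ultimately show ?thesis by (simp add: filterlim_split_at_real)
qed

lemma flat_has_real_derivative: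
  "(flat m has_real_derivative flat (m + 2) t - real m * flat (m + 1) t) (at t)"
proof -
  consider "t > 0" | "t = 0" | "t < 0" by linarith
  then show ?thesis
  proof cases
    case 1
    have "((\<lambda>t. exp (- inverse t) * inverse t ^ m) has_real_derivative
        flat (m + 2) t - real m * flat (m + 1) t) (at t)"
    proof -
      have "((\<lambda>t. inverse t ^ m) has_real_derivative - real m * inverse t ^ (m + 1)) (at t)"
      proof (rule DERIV_cong[OF DERIV_power[OF DERIV_inverse[of t], of m]])
        show "of_nat m * (- (inverse t ^ Suc (Suc 0)) * inverse t ^ (m - Suc 0)) =
            - real m * inverse t ^ (m + 1)"
          by (cases m) (simp_all add: algebra_simps)
      qed (use 1 in simp)
      moreover have "((\<lambda>t. exp (- inverse t)) has_real_derivative exp (- inverse t) * inverse t ^ 2) (at t)"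
        using DERIV_chain2[OF DERIV_exp DERIV_minus[OF DERIV_inverse[of t]]] 1
        by (simp add: power2_eq_square)
      ultimately have "((\<lambda>t. exp (- inverse t) * inverse t ^ m) has_real_derivative
          exp (- inverse t) * (- real m * inverse t ^ (m + 1)) +
          exp (- inverse t) * inverse t ^ 2 * inverse t ^ m) (at t)"
        by (rule DERIV_mult'[rotated])
      then show ?thesis
        using 1 by (simp add: flat_def power_add power2_eq_square mult_ac)
    qed
    then show ?thesis
      by (rule has_field_derivative_transform_within_open[where S = "{0<..}"])
        (use 1 in \<open>auto simp: flat_def\<close>)
  next
    case 2
    \<comment> \<open>At 0 the difference quotient of one member is the next member of the family;
      for h = 0 both sides are 0 because division by 0 gives 0.\<close>
    have "flat (Suc m) = (\<lambda>h. (flat m (0 + h) - flat m 0) / h)"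
      by (auto simp: flat_def divide_inverse)
    moreover have "flat (m + 2) 0 - real m * flat (m + 1) 0 = 0"
      by (simp add: flat_def)
    ultimately show ?thesis
      using flat_tendsto_0[of "Suc m"] unfolding DERIV_def 2 by simp
  next
    case 3
    have "((\<lambda>t. 0) has_real_derivative flat (m + 2) t - real m * flat (m + 1) t) (at t)"
      using 3 by (simp add: flat_def)
    then show ?thesis
      by (rule has_field_derivative_transform_within_open[where S = "{..<0}"])
        (use 3 in \<open>auto simp: flat_def\<close>)
  qed
qed

lemma Ck_on_flat: "Ck_on k UNIV (flat m)"
proof (induction k arbitrary: m)
  case 0
  show ?case
    unfolding Ck_on.simps
    by (intro continuous_at_imp_continuous_on ballI) (rule DERIV_isCont, rule flat_has_real_derivative)
next
  case (Suc k)
  show ?case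
  proof (rule Ck_on_SucI)
    show "(flat m has_derivative (\<lambda>v. v * (flat (m + 2) t + (- real m) * flat (m + 1) t))) (at t)" for t
      by (rule has_derivative_eq_rhs
          [OF has_field_derivative_imp_has_derivative[OF flat_has_real_derivative[of m t]]])
        (auto simp: fun_eq_iff algebra_simps)
    show "Ck_on k UNIV (\<lambda>t. v * (flat (m + 2) t + (- real m) * flat (m + 1) t))" for v
      by (intro Ck_on_mult Ck_on_add Ck_on_const Suc open_UNIV)
  qed simp
qed

text \<open>Squaring the norm avoids its singularity at the centre. There is no normalisation: for r
  > 0 the value at the centre is exp(-1/r^2), which is why later proofs divide by it.\<close>

definition bump :: "'a::euclidean_space \<Rightarrow> real \<Rightarrow> 'a \<Rightarrow> real"
  where "bump a r x = flat 0 (r\<^sup>2 - (norm (x - a))\<^sup>2)"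

lemma bump_pos: "norm (x - a) < r \<Longrightarrow> bump a r x > 0"
  using power_strict_mono[of "norm (x - a)" r 2] by (auto simp: bump_def flat_def)

lemma bump_eq_0:
  assumes "r > 0" "x \<notin> cball a r"
  shows "bump a r x = 0"
proof -
  have "r\<^sup>2 \<le> (norm (x - a))\<^sup>2"
    using assms by (intro power_mono) (auto simp: dist_norm norm_minus_commute)
  then show ?thesis by (auto simp: bump_def flat_def)
qed

lemma Ck_on_bump: "Ck_on k UNIV (bump a r)"
proof -
  have *: "Ck_on k UNIV (\<lambda>x. r\<^sup>2 + (\<Sum>b\<in>Basis. (-1) * (((x + (-a)) \<bullet> b) * ((x + (-a)) \<bullet> b))))"
    by (intro Ck_on_add Ck_on_sum Ck_on_mult Ck_on_const Ck_on_ident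
        Ck_on_linear_compose[OF bounded_linear_inner_left]) auto
  have "bump a r = (\<lambda>x. flat 0 (r\<^sup>2 + (\<Sum>b\<in>Basis. (-1) * (((x + (-a)) \<bullet> b) * ((x + (-a)) \<bullet> b)))))"
  proof
    fix x
    have "(norm (x - a))\<^sup>2 = (\<Sum>b\<in>Basis. ((x + (-a)) \<bullet> b) * ((x + (-a)) \<bullet> b))"
      unfolding power2_norm_eq_inner by (subst euclidean_inner) simp
    then show "bump a r x = flat 0 (r\<^sup>2 + (\<Sum>b\<in>Basis. (-1) * (((x + (-a)) \<bullet> b) * ((x + (-a)) \<bullet> b))))"
      unfolding bump_def by (simp only: sum_distrib_left[symmetric] mult_minus1 sum_negf diff_conv_add_uminus)
  qed
  then show ?thesis
    using Ck_on_compose[OF * Ck_on_flat] by simp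
qed

section \<open>Averages along segments and Hadamard's lemma\<close>

lemma segment_mem_ball:
  fixes x a :: "'a::real_normed_vector"
  assumes "x \<in> ball a R" "t \<in> {0..1}"
  shows "a + t *\<^sub>R (x - a) \<in> ball a R"
proof -
  have "norm (t *\<^sub>R (x - a)) \<le> norm (x - a)"
    using assms by (simp add: mult_left_le_one_le)
  then show ?thesis
    using assms by (simp add: dist_norm norm_minus_commute)
qed

lemma continuous_on_segment:
  fixes G :: "'a::real_normed_vector \<Rightarrow> real"
  assumes "continuous_on (ball a R) G"
  shows "continuous_on (ball a R \<times> cbox 0 1) (\<lambda>z. snd z ^ m * G (a + snd z *\<^sub>R (fst z - a)))"
  by (intro continuous_intros continuous_on_compose2[OF assms])
    (auto simp: segment_mem_ball simp del: mem_ball)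

lemma integrable_on_segment:
  fixes G :: "'a::real_normed_vector \<Rightarrow> real"
  assumes "continuous_on (ball a R) G" "x \<in> ball a R"
  shows "(\<lambda>t. t ^ m * G (a + t *\<^sub>R (x - a))) integrable_on cbox 0 1"
  using assms(2) by (intro integrable_continuous continuous_intros continuous_on_compose2[OF assms(1)])
    (auto simp: segment_mem_ball simp del: mem_ball)

text \<open>Each differentiation under the integral sign produces a factor t by the chain rule. The
  weight \<open>t ^ m\<close> absorbs it, so the induction has to treat all m
  simultaneously.\<close>

lemma Ck_on_integral_segment:
  fixes F :: "'a::euclidean_space \<Rightarrow> real"
  assumes "Ck_on k (ball a R) F"
  shows "Ck_on k (ball a R) (\<lambda>x. integral {0..1} (\<lambda>t. t ^ m * F (a + t *\<^sub>R (x - a))))"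
using assms
proof (induction k arbitrary: F m)
    case 0
    show ?case
      using integral_continuous_on_param[of "ball a R" 0 1 "\<lambda>x t. t ^ m * F (a + t *\<^sub>R (x - a))"]
        continuous_on_segment[of a R F m] 0 by (simp add: split_beta)
  next
    case (Suc k)
    define F' where "F' b x = frechet_derivative F (at x) b" for b x
    have F': "(F has_derivative (\<lambda>v. \<Sum>b\<in>Basis. (v \<bullet> b) * F' b x)) (at x)" if "x \<in> ball a R" for x
    proof -
      have "(F has_derivative frechet_derivative F (at x)) (at x)"
        using Suc.prems that by (auto simp: frechet_derivative_works)
      from has_derivative_Basis[OF this] show ?thesis unfolding F'_def real_scaleR_def .
    qed
    have Ck: "Ck_on k (ball a R) (F' b)" for b
      using Suc.prems unfolding F'_def by simp
    have F'_cont: "continuous_on (ball a R) (F' b)" for b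
      using Ck Ck_on_imp_continuous_on by blast
    \<comment> \<open>The derivative of the integrand in x, as a bounded linear operator: this is
      the form in which the Leibniz rule for parameter integrals asks for it.\<close>
    let ?D = "\<lambda>x t. \<Sum>b\<in>Basis. (t ^ Suc m * F' b (a + t *\<^sub>R (x - a))) *\<^sub>R blinfun_inner_left b"
    let ?I = "\<lambda>x b. integral {0..1} (\<lambda>t. t ^ Suc m * F' b (a + t *\<^sub>R (x - a)))"
    show ?case
    proof (rule Ck_on_SucI)
      fix x assume x: "x \<in> ball a R"
      have "((\<lambda>x. integral (cbox 0 1) (\<lambda>t. t ^ m * F (a + t *\<^sub>R (x - a)))) has_derivative
          integral (cbox 0 1) (?D x)) (at x within ball a R)"
      proof (rule leibniz_rule)
        fix y t assume y: "y \<in> ball a R" and t: "t \<in> cbox (0::real) 1"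
        have "((\<lambda>x. a + t *\<^sub>R (x - a)) has_derivative (\<lambda>v. t *\<^sub>R v)) (at y)"
          by (auto intro!: derivative_eq_intros)
        from has_derivative_compose[OF this F'] segment_mem_ball[OF y] t
        have "((\<lambda>x. t ^ m * F (a + t *\<^sub>R (x - a))) has_derivative
            (\<lambda>v. t ^ m * (\<Sum>b\<in>Basis. (t *\<^sub>R v \<bullet> b) * F' b (a + t *\<^sub>R (y - a))))) (at y)"
          by (intro has_derivative_mult_right) auto
        moreover have "blinfun_apply (?D y t) =
            (\<lambda>v. t ^ m * (\<Sum>b\<in>Basis. (t *\<^sub>R v \<bullet> b) * F' b (a + t *\<^sub>R (y - a))))"
          by (rule ext) (simp add: blinfun.sum_left blinfun.scaleR_left sum_distrib_left
              inner_commute mult_ac)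
        ultimately show "((\<lambda>x. t ^ m * F (a + t *\<^sub>R (x - a))) has_derivative
            blinfun_apply (?D y t)) (at y within ball a R)"
          by (simp add: has_derivative_at_withinI)
      next
        show "continuous_on (ball a R \<times> cbox 0 1) (\<lambda>(x, t). ?D x t)"
          unfolding split_beta by (intro continuous_intros continuous_on_segment F'_cont)
      next
        have "continuous_on (ball a R) F"
          using F' has_derivative_continuous continuous_at_imp_continuous_on by blast
        then show "(\<lambda>t. t ^ m * F (a + t *\<^sub>R (y - a))) integrable_on cbox 0 1" if "y \<in> ball a R" for y
          using integrable_on_segment that by blast
      qed (use x in auto)
      moreover have "integral (cbox 0 1) (?D x) = (\<Sum>b\<in>Basis. ?I x b *\<^sub>R blinfun_inner_left b)"
        using integrable_on_segment[OF F'_cont x]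
        by (subst integral_sum)
          (auto intro!: sum.cong integrable_on_scaleR_left integral_unique has_integral_scaleR_left
            integrable_integral simp del: power_Suc)
      moreover have "blinfun_apply (\<Sum>b\<in>Basis. ?I x b *\<^sub>R blinfun_inner_left b) =
          (\<lambda>v. \<Sum>b\<in>Basis. (v \<bullet> b) * ?I x b)"
        by (rule ext) (simp add: blinfun.sum_left blinfun.scaleR_left inner_commute mult_ac)
      ultimately show "((\<lambda>x. integral {0..1} (\<lambda>t. t ^ m * F (a + t *\<^sub>R (x - a)))) has_derivative
          (\<lambda>v. \<Sum>b\<in>Basis. (v \<bullet> b) * ?I x b)) (at x)"
        using x by (simp add: at_within_open[OF x open_ball])
    next
      show "Ck_on k (ball a R) (\<lambda>x. \<Sum>b\<in>Basis. (v \<bullet> b) * ?I x b)" for v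
        by (intro Ck_on_sum Ck_on_mult Ck_on_const Suc.IH Ck) auto
    qed simp
qed

text \<open>The fundamental theorem of calculus along the segment from a to x. \<open>G b\<close> is
  the mean over that segment of the partial derivative in direction b; at x = a the segment
  degenerates and the mean is the derivative itself.\<close>

lemma Hadamard:
  fixes F :: "'a::euclidean_space \<Rightarrow> real"
  assumes "smooth_on (ball a R) F" "R > 0"
  obtains G where "\<And>b. smooth_on (ball a R) (G b)"
    and "\<And>x. x \<in> ball a R \<Longrightarrow> F x = F a + (\<Sum>b\<in>Basis. ((x - a) \<bullet> b) * G b x)"
    and "\<And>b. G b a = frechet_derivative F (at a) b"
proof -
  define F' where "F' b x = frechet_derivative F (at x) b" for b x
  define G where "G b x = integral {0..1} (\<lambda>t. t ^ 0 * F' b (a + t *\<^sub>R (x - a)))" for b x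
  have F': "Ck_on k (ball a R) (F' b)" for k b
    using assms(1) Ck_on.simps(2) unfolding F'_def smooth_on_def by blast
  show ?thesis
  proof (rule that[of G])
    show "smooth_on (ball a R) (G b)" for b
      using Ck_on_integral_segment[OF F'] unfolding smooth_on_def G_def by blast
    show "G b a = frechet_derivative F (at a) b" for b
      by (simp add: G_def F'_def)
    fix x assume x: "x \<in> ball a R"
    have F_deriv: "(F has_derivative (\<lambda>v. \<Sum>b\<in>Basis. (v \<bullet> b) * F' b y)) (at y)" if "y \<in> ball a R" for y
    proof -
      have "Ck_on (Suc 0) (ball a R) F" using assms(1) smooth_on_def by blast
      then have "(F has_derivative frechet_derivative F (at y)) (at y)"
        using that by (auto simp: frechet_derivative_works)
      from has_derivative_Basis[OF this] show ?thesis unfolding F'_def real_scaleR_def .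
    qed
    have "((\<lambda>t. F (a + t *\<^sub>R (x - a))) has_vector_derivative
        (\<Sum>b\<in>Basis. ((x - a) \<bullet> b) * F' b (a + t *\<^sub>R (x - a)))) (at t within {0..1})"
      if t: "t \<in> {0..1}" for t
    proof -
      have "((\<lambda>t. a + t *\<^sub>R (x - a)) has_derivative (\<lambda>h. h *\<^sub>R (x - a))) (at t)"
        by (auto intro!: derivative_eq_intros)
      from has_derivative_compose[OF this F_deriv[OF segment_mem_ball[OF x t]]]
      have "((\<lambda>t. F (a + t *\<^sub>R (x - a))) has_derivative
          (\<lambda>h. h *\<^sub>R (\<Sum>b\<in>Basis. ((x - a) \<bullet> b) * F' b (a + t *\<^sub>R (x - a))))) (at t)"
        by (simp add: sum_distrib_left mult_ac)
      then show ?thesis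
        by (simp add: has_vector_derivative_def has_derivative_at_withinI)
    qed
    then have "((\<lambda>t. \<Sum>b\<in>Basis. ((x - a) \<bullet> b) * F' b (a + t *\<^sub>R (x - a))) has_integral
        F x - F a) {0..1}"
      using fundamental_theorem_of_calculus[of 0 1 "\<lambda>t. F (a + t *\<^sub>R (x - a))"] by simp
    then have "F x - F a =
        integral {0..1} (\<lambda>t. \<Sum>b\<in>Basis. ((x - a) \<bullet> b) * F' b (a + t *\<^sub>R (x - a)))"
      by (simp add: integral_unique)
    also have "\<dots> = (\<Sum>b\<in>Basis. ((x - a) \<bullet> b) * G b x)"
    proof -
      have "continuous_on (ball a R) (F' b)" for b
        using F'[of 0 b] by simp
      from integrable_on_segment[OF this x, of 0]
      have "(\<lambda>t. F' b (a + t *\<^sub>R (x - a))) integrable_on {0..1}" for b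
        by simp
      then show ?thesis
        by (subst integral_sum) (auto simp: G_def intro: integrable_on_mult_right)
    qed
    finally show "F x = F a + (\<Sum>b\<in>Basis. ((x - a) \<bullet> b) * G b x)" by simp
  qed
qed

section \<open>Tangent spaces\<close>

lemma smooth_on_subset: "smooth_on S f \<Longrightarrow> T \<subseteq> S \<Longrightarrow> smooth_on T f"
  unfolding smooth_on_def using Ck_on_subset by blast

lemma smooth_on_add:
  "smooth_on S f \<Longrightarrow> smooth_on S g \<Longrightarrow> open S \<Longrightarrow> smooth_on S (\<lambda>x. f x + g x)"
  unfolding smooth_on_def using Ck_on_add by blast

lemma smooth_on_mult:
  fixes f g :: "'a::euclidean_space \<Rightarrow> real"
  shows "smooth_on S f \<Longrightarrow> smooth_on S g \<Longrightarrow> open S \<Longrightarrow> smooth_on S (\<lambda>x. f x * g x)"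
  unfolding smooth_on_def using Ck_on_mult by blast

lemma smooth_on_const: "smooth_on S (\<lambda>x. c)"
  unfolding smooth_on_def using Ck_on_const by blast

lemma smooth_on_bump: "smooth_on S (bump a r)"
  unfolding smooth_on_def using Ck_on_bump Ck_on_subset by blast

lemma smooth_on_frechet_derivative:
  "smooth_on S f \<Longrightarrow> smooth_on S (\<lambda>x. frechet_derivative f (at x) v)"
  unfolding smooth_on_def using Ck_on.simps(2) by blast

lemma smooth_on_has_derivative:
  "smooth_on S f \<Longrightarrow> x \<in> S \<Longrightarrow> (f has_derivative frechet_derivative f (at x)) (at x)"
  unfolding smooth_on_def frechet_derivative_works[symmetric] using Ck_on.simps(2) by blast

lemma smooth_on_coordinate: "open S \<Longrightarrow> smooth_on S (\<lambda>x. (x - a) \<bullet> b)"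
  unfolding smooth_on_def diff_conv_add_uminus
  by (intro allI Ck_on_linear_compose[OF bounded_linear_inner_left] Ck_on_add Ck_on_ident Ck_on_const)

lemma smooth_atlas_chart:
  assumes "smooth_atlas \<A>" "(U, c) \<in> \<A>"
  shows "open U" "open (c ` U)" "homeomorphism U (c ` U) c (inv_into U c)"
  using assms unfolding smooth_atlas_def by auto

lemma smooth_atlas_inv_into:
  assumes "smooth_atlas \<A>" "(U, c) \<in> \<A>" "q \<in> U"
  shows "inv_into U c (c q) = q"
  using homeomorphism_apply1[OF smooth_atlas_chart(3)[OF assms(1,2)] assms(3)] .

lemma smooth_atlas_open_image:
  assumes "smooth_atlas \<A>" "(U, c) \<in> \<A>" "open W" "W \<subseteq> U"
  shows "open (c ` W)"
  using homeomorphism_imp_open_map[OF smooth_atlas_chart(3)[OF assms(1,2)], of W]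
    smooth_atlas_chart(1,2)[OF assms(1,2)] assms(3,4)
  by (simp add: openin_open_eq)

lemma smooth_functions_add:
  assumes "smooth_atlas \<A>" "f \<in> smooth_functions \<A>" "h \<in> smooth_functions \<A>"
  shows "f + h \<in> smooth_functions \<A>"
  using assms(2,3) smooth_atlas_chart(2)[OF assms(1)]
  unfolding smooth_functions_def comp_def plus_fun_def by (auto intro: smooth_on_add)

lemma smooth_functions_mult:
  assumes "smooth_atlas \<A>" "f \<in> smooth_functions \<A>" "h \<in> smooth_functions \<A>"
  shows "f * h \<in> smooth_functions \<A>"
  using assms(2,3) smooth_atlas_chart(2)[OF assms(1)]
  unfolding smooth_functions_def comp_def times_fun_def by (auto intro: smooth_on_mult)

lemma smooth_functions_const: "(\<lambda>x. k) \<in> smooth_functions \<A>"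
  unfolding smooth_functions_def comp_def by (auto intro: smooth_on_const)

lemma smooth_functions_scaleR:
  assumes "smooth_atlas \<A>" "f \<in> smooth_functions \<A>"
  shows "k *\<^sub>R f \<in> smooth_functions \<A>"
  using smooth_functions_mult[OF assms(1) smooth_functions_const[of k] assms(2)]
  by (simp add: scaleR_fun_def times_fun_def)

lemma smooth_functions_sum:
  assumes "smooth_atlas \<A>" "\<And>i. i \<in> I \<Longrightarrow> f i \<in> smooth_functions \<A>"
  shows "(\<Sum>i\<in>I. f i) \<in> smooth_functions \<A>"
  using assms(2)
  by (induction I rule: infinite_finite_induct)
    (use smooth_functions_const[of 0] in \<open>auto simp: zero_fun_def intro: smooth_functions_add[OF assms(1)]\<close>)

text \<open>Turns a function of the coordinates into a candidate global function, the only kind on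
  which tangent vectors are tested.\<close>

definition extend_zero :: "'m set \<Rightarrow> ('m \<Rightarrow> 'a) \<Rightarrow> ('a \<Rightarrow> real) \<Rightarrow> 'm \<Rightarrow> real"
  where "extend_zero U c F q = (if q \<in> U then F (c q) else 0)"

text \<open>On the preimage of the large ball the extension is F in coordinates, off the preimage of
  the small closed ball it is 0. Both sets are open and they cover the manifold.\<close>

lemma extend_zero_smooth:
  assumes "smooth_atlas \<A>" "(U, c) \<in> \<A>" "ball a (2 * r) \<subseteq> c ` U" "r > 0"
    and F: "smooth_on (ball a (2 * r)) F" "\<And>x. x \<notin> cball a r \<Longrightarrow> F x = 0"
  shows "extend_zero U c F \<in> smooth_functions \<A>"
  unfolding smooth_functions_def mem_Collect_eq
proof safe
  fix V d assume V: "(V, d) \<in> \<A>"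
  let ?K = "inv_into U c ` cball a r"
  note hom = smooth_atlas_chart(3)[OF assms(1,2)]
  have sub: "cball a r \<subseteq> ball a (2 * r)"
    using \<open>r > 0\<close> by auto
  have "compact ?K"
    using homeomorphism_cont2[OF hom] sub assms(3)
    by (intro compact_continuous_image) (auto intro: continuous_on_subset)
  \<comment> \<open>The Hausdorff property enters here: otherwise compact sets need not be closed,
    and the extension may fail to be continuous.\<close>
  then have "closed ?K"
    by (rule compact_imp_closed)
  have "Ck_on k (d ` V) (extend_zero U c F \<circ> inv_into V d)" for k
  proof (rule Ck_on_locally)
    fix y assume "y \<in> d ` V"
    then obtain q where q: "q \<in> V" "y = d q" by blast
    show "\<exists>T. open T \<and> y \<in> T \<and> Ck_on k T (extend_zero U c F \<circ> inv_into V d)"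
    proof (cases "q \<in> ?K")
      case True
      let ?W = "V \<inter> inv_into U c ` ball a (2 * r)"
      have "open (inv_into U c ` ball a (2 * r))"
        using homeomorphism_imp_open_map[OF homeomorphism_symD[OF hom], of "ball a (2 * r)"]
          smooth_atlas_chart(1,2)[OF assms(1,2)] assms(3)
        by (simp add: openin_open_eq)
      then have op: "open (d ` ?W)"
        using smooth_atlas_chart(1)[OF assms(1) V] by (intro smooth_atlas_open_image[OF assms(1) V]) auto
      have U: "inv_into U c x \<in> U" and c: "c (inv_into U c x) = x" if "x \<in> ball a (2 * r)" for x
        using assms(3) that by (auto simp: inv_into_into f_inv_into_f)
      have Vd: "inv_into V d (d z) = z" if "z \<in> V" for z
        using smooth_atlas_inv_into[OF assms(1) V that] .
      have "smooth_on (d ` (V \<inter> U)) (c \<circ> inv_into V d)"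
        using assms(1,2) V unfolding smooth_atlas_def by blast
      then have "Ck_on k (d ` ?W) (c \<circ> inv_into V d)"
        unfolding smooth_on_def using U by (blast intro: Ck_on_subset)
      moreover have "Ck_on k (ball a (2 * r)) F"
        using F(1) smooth_on_def by blast
      moreover have "(c \<circ> inv_into V d) ` d ` ?W \<subseteq> ball a (2 * r)"
        by (auto simp: Vd c simp del: mem_ball)
      ultimately have "Ck_on k (d ` ?W) (\<lambda>x. F ((c \<circ> inv_into V d) x))"
        using op by (rule Ck_on_compose)
      then have "Ck_on k (d ` ?W) (extend_zero U c F \<circ> inv_into V d)"
        by (rule Ck_on_cong[OF _ _ op]) (auto simp: extend_zero_def Vd U simp del: mem_ball)
      moreover have "y \<in> d ` ?W"
        using q True sub by blast
      ultimately show ?thesis using op by blast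
    next
      case False
      have op: "open (d ` (V - ?K))"
        using smooth_atlas_chart(1)[OF assms(1) V] \<open>closed ?K\<close>
        by (intro smooth_atlas_open_image[OF assms(1) V]) auto
      have "extend_zero U c F z = 0" if "z \<in> V - ?K" for z
      proof (cases "z \<in> U")
        case True
        then have "z = inv_into U c (c z)"
          using smooth_atlas_inv_into[OF assms(1,2)] by simp
        then have "c z \<notin> cball a r" using that by blast
        then show ?thesis using F(2) by (simp add: extend_zero_def)
      qed (simp add: extend_zero_def)
      then have "Ck_on k (d ` (V - ?K)) (extend_zero U c F \<circ> inv_into V d)"
        using smooth_atlas_inv_into[OF assms(1) V]
        by (intro Ck_on_cong[OF Ck_on_const[of _ _ 0] _ op]) auto
      moreover have "y \<in> d ` (V - ?K)"
        using q False by blast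
      ultimately show ?thesis using op by blast
    qed
  qed
  then show "smooth_on (d ` V) (extend_zero U c F \<circ> inv_into V d)"
    unfolding smooth_on_def by blast
qed

section \<open>Derivations at a point in coordinates\<close>

lemma scaleR_fun_apply [simp]: "(k *\<^sub>R f) x = k *\<^sub>R f x"
  by (simp add: scaleR_fun_def)

lemma sum_fun_apply: "(\<Sum>i\<in>I. f i) x = (\<Sum>i\<in>I. f i x)"
  for f :: "'i \<Rightarrow> 'a \<Rightarrow> 'b::comm_monoid_add"
  by (induction I rule: infinite_finite_induct) auto

lemma linear_on_sum:
  assumes "linear_on S T" "subspace S" "\<And>i. i \<in> I \<Longrightarrow> f i \<in> S"
  shows "T (\<Sum>i\<in>I. f i) = (\<Sum>i\<in>I. T (f i))"
proof -
  have "T 0 = 0"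
    using assms(1) subspace_0[OF assms(2)] unfolding linear_on_def by (metis scaleR_zero_left)
  moreover have "T (x + y) = T x + T y" if "x \<in> S" "y \<in> S" for x y
    using assms(1) that unfolding linear_on_def by blast
  ultimately show ?thesis
    using assms(3)
    by (induction I rule: infinite_finite_induct) (auto simp: subspace_sum[OF assms(2)])
qed

lemma subspace_smooth_functions: "smooth_atlas \<A> \<Longrightarrow> subspace (smooth_functions \<A>)"
  using smooth_functions_const[of 0] smooth_functions_add smooth_functions_scaleR
  unfolding subspace_def zero_fun_def by blast

lemma subspace_tangent_space: "subspace (tangent_space \<A> p)"
  unfolding subspace_def tangent_space_def linear_on_def by (auto simp: algebra_simps)

text \<open>Meaningful for q in U only. The default 0 on non-smooth functions agrees with the last
  clause of \<open>tangent_space\<close>, so that tangent vectors can be equal to these derivations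
  as functions.\<close>

definition coordinate_derivation ::
    "('m, 'n::finite) atlas \<Rightarrow> 'm set \<Rightarrow> ('m \<Rightarrow> real ^ 'n) \<Rightarrow> real ^ 'n \<Rightarrow> 'm vfield"
  where "coordinate_derivation \<A> U c w q f =
    (if f \<in> smooth_functions \<A> then frechet_derivative (f \<circ> inv_into U c) (at (c q)) w else 0)"

lemma smooth_functions_has_derivative:
  assumes "(U, c) \<in> \<A>" "q \<in> U" "f \<in> smooth_functions \<A>"
  shows "((f \<circ> inv_into U c) has_derivative (\<lambda>w. coordinate_derivation \<A> U c w q f)) (at (c q))"
  using smooth_on_has_derivative[of "c ` U" "f \<circ> inv_into U c" "c q"] assms
  unfolding coordinate_derivation_def smooth_functions_def by auto

lemma coordinate_derivation_eqI:
  assumes "(U, c) \<in> \<A>" "q \<in> U" "f \<in> smooth_functions \<A>"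
    and "((f \<circ> inv_into U c) has_derivative F) (at (c q))"
  shows "coordinate_derivation \<A> U c w q f = F w"
  using has_derivative_unique[OF smooth_functions_has_derivative[OF assms(1-3)] assms(4)] by meson

lemma linear_coordinate_derivation:
  assumes "(U, c) \<in> \<A>" "q \<in> U"
  shows "linear (\<lambda>w. coordinate_derivation \<A> U c w q)"
proof -
  have lin: "linear (\<lambda>w. coordinate_derivation \<A> U c w q f)" for f
  proof (cases "f \<in> smooth_functions \<A>")
    case True
    show ?thesis
      using has_derivative_linear[OF smooth_functions_has_derivative[OF assms True]] .
  qed (simp add: coordinate_derivation_def linear_zero)
  show ?thesis
    using linear_add[OF lin] linear_scale[OF lin] by (intro linearI ext) auto
qed

lemma coordinate_derivation_tangent:
  assumes atlas: "smooth_atlas \<A>" and q: "(U, c) \<in> \<A>" "q \<in> U"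
  shows "coordinate_derivation \<A> U c w q \<in> tangent_space \<A> q"
proof -
  note d = smooth_functions_has_derivative[OF q]
  have add: "coordinate_derivation \<A> U c w q (f + h) =
      coordinate_derivation \<A> U c w q f + coordinate_derivation \<A> U c w q h"
    if "f \<in> smooth_functions \<A>" "h \<in> smooth_functions \<A>" for f h
    using has_derivative_add[OF d[OF that(1)] d[OF that(2)]]
    by (intro coordinate_derivation_eqI[OF q smooth_functions_add[OF atlas that]]) (simp add: comp_def)
  have scaleR: "coordinate_derivation \<A> U c w q (k *\<^sub>R f) = k *\<^sub>R coordinate_derivation \<A> U c w q f"
    if "f \<in> smooth_functions \<A>" for f k
    using has_derivative_scaleR_right[OF d[OF that], of k]
    by (intro coordinate_derivation_eqI[OF q smooth_functions_scaleR[OF atlas that]]) (simp add: comp_def)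
  have mult: "coordinate_derivation \<A> U c w q (f * h) =
      f q * coordinate_derivation \<A> U c w q h + h q * coordinate_derivation \<A> U c w q f"
    if "f \<in> smooth_functions \<A>" "h \<in> smooth_functions \<A>" for f h
    using has_derivative_mult[OF d[OF that(1)] d[OF that(2)]]
    by (intro coordinate_derivation_eqI[OF q smooth_functions_mult[OF atlas that]])
      (simp add: comp_def smooth_atlas_inv_into[OF atlas q] mult.commute)
  show ?thesis
    unfolding tangent_space_def linear_on_def
    using add scaleR mult by (auto simp: coordinate_derivation_def)
qed

text \<open>A derivation is determined by its values on the coordinates cut off by a bump: in
  Hadamard's expansion each coordinate vanishes at p, so the Leibniz rule keeps one term per
  product. The cutoff occurs squared because the coordinate and its Hadamard coefficient both have
  to be made global.\<close>

lemma tangent_vector_coordinates: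
  assumes atlas: "smooth_atlas \<A>" and p: "(U, c) \<in> \<A>" "p \<in> U"
    and r: "ball (c p) (2 * r) \<subseteq> c ` U" "r > 0"
    and v: "v \<in> tangent_space \<A> p"
  shows "\<exists>w. v = coordinate_derivation \<A> U c w p"
proof -
  define a where "a = c p"
  define \<rho> where "\<rho> = bump a r"
  define \<theta> where "\<theta> = extend_zero U c \<rho>"
  define y where "y b = extend_zero U c (\<lambda>x. \<rho> x * ((x - a) \<bullet> b))" for b
  have \<rho>0: "\<rho> x = 0" if "x \<notin> cball a r" for x
    using bump_eq_0[OF r(2) that] by (simp add: \<rho>_def)
  have \<rho>a: "\<rho> a > 0"
    using bump_pos[of a a r] r(2) by (simp add: \<rho>_def)
  have smooth: "extend_zero U c F \<in> smooth_functions \<A>"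
    if "smooth_on (ball a (2 * r)) F" "\<And>x. x \<notin> cball a r \<Longrightarrow> F x = 0" for F
    using extend_zero_smooth[OF atlas p(1) r[folded a_def] that] .
  have \<rho>s: "smooth_on (ball a (2 * r)) \<rho>"
    unfolding \<rho>_def by (rule smooth_on_bump)
  have \<theta>: "\<theta> \<in> smooth_functions \<A>" and y: "y b \<in> smooth_functions \<A>" for b
    unfolding \<theta>_def y_def
    by (intro smooth smooth_on_mult smooth_on_coordinate \<rho>s open_ball; simp add: \<rho>0)+
  have \<theta>p: "\<theta> p = \<rho> a" and yp: "y b p = 0" for b
    using p(2) by (auto simp: \<theta>_def y_def extend_zero_def a_def)
  have vmult: "v (f * h) = f p * v h + h p * v f"
    if "f \<in> smooth_functions \<A>" "h \<in> smooth_functions \<A>" for f h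
    using v that unfolding tangent_space_def by blast
  have vlin: "linear_on (smooth_functions \<A>) v"
    using v unfolding tangent_space_def by blast
  \<comment> \<open>At p the function \<open>y b\<close> has as derivative \<open>\<rho> a\<close>
    times the coordinate in direction b, hence the division.\<close>
  define w where "w = (\<Sum>b\<in>Basis. (v (y b) / \<rho> a) *\<^sub>R b)"
  have "v f = coordinate_derivation \<A> U c w p f" for f
  proof (cases "f \<in> smooth_functions \<A>")
    case True
    define F where "F = f \<circ> inv_into U c"
    have "smooth_on (ball a (2 * r)) F"
      using True p(1) r(1) unfolding F_def smooth_functions_def a_def by (auto intro: smooth_on_subset)
    then obtain G where G: "\<And>b. smooth_on (ball a (2 * r)) (G b)"
      and FG: "\<And>x. x \<in> ball a (2 * r) \<Longrightarrow> F x = F a + (\<Sum>b\<in>Basis. ((x - a) \<bullet> b) * G b x)"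
      and Ga: "\<And>b. G b a = frechet_derivative F (at a) b"
      by (rule Hadamard) (use r(2) in simp, rule that, assumption+)
    define H where "H b = extend_zero U c (\<lambda>x. \<rho> x * G b x)" for b
    have H: "H b \<in> smooth_functions \<A>" for b
      unfolding H_def by (rule smooth[OF smooth_on_mult[OF \<rho>s G open_ball]]) (simp add: \<rho>0)
    have Hp: "H b p = \<rho> a * coordinate_derivation \<A> U c b p f" for b
      using p(2) Ga True by (simp add: H_def extend_zero_def a_def F_def coordinate_derivation_def)
    \<comment> \<open>Hadamard's expansion of \<open>f\<close> times the square of the cutoff is an identity between global
      smooth functions, to which the derivation \<open>v\<close> can be applied.\<close>
    have "\<theta> * (\<theta> * f) = f p *\<^sub>R (\<theta> * \<theta>) + (\<Sum>b\<in>Basis. y b * H b)"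
    proof
      fix q
      show "(\<theta> * (\<theta> * f)) q = (f p *\<^sub>R (\<theta> * \<theta>) + (\<Sum>b\<in>Basis. y b * H b)) q"
      proof (cases "q \<in> U \<and> c q \<in> cball a r")
        case True
        then have "c q \<in> ball a (2 * r)" using r(2) by auto
        from FG[OF this] have "f q = f p + (\<Sum>b\<in>Basis. ((c q - a) \<bullet> b) * G b (c q))"
          using True smooth_atlas_inv_into[OF atlas p(1)] p(2) by (simp add: F_def a_def)
        then show ?thesis
          using True
          by (simp add: sum_fun_apply \<theta>_def y_def H_def extend_zero_def sum_distrib_left algebra_simps)
      next
        case False
        then show ?thesis
          by (auto simp: sum_fun_apply \<theta>_def y_def H_def extend_zero_def \<rho>0)
      qed
    qed
    moreover have "v (f p *\<^sub>R (\<theta> * \<theta>) + (\<Sum>b\<in>Basis. y b * H b)) =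
        f p *\<^sub>R v (\<theta> * \<theta>) + (\<Sum>b\<in>Basis. v (y b * H b))"
    proof -
      have "(\<Sum>b\<in>Basis. y b * H b) \<in> smooth_functions \<A>"
        by (intro smooth_functions_sum smooth_functions_mult atlas y H)
      then show ?thesis
        using vlin smooth_functions_mult[OF atlas \<theta> \<theta>] smooth_functions_scaleR[OF atlas]
          linear_on_sum[OF vlin subspace_smooth_functions[OF atlas], of Basis "\<lambda>b. y b * H b"]
          smooth_functions_mult[OF atlas y H]
        unfolding linear_on_def by auto
    qed
    moreover have "v (\<theta> * (\<theta> * f)) = \<rho> a * (\<rho> a * v f) + 2 * (\<rho> a * f p * v \<theta>)"
      using vmult[OF \<theta> smooth_functions_mult[OF atlas \<theta> True]] vmult[OF \<theta> True]
      by (simp add: \<theta>p algebra_simps)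
    moreover have "v (\<theta> * \<theta>) = 2 * (\<rho> a * v \<theta>)"
      using vmult[OF \<theta> \<theta>] by (simp add: \<theta>p)
    moreover have "v (y b * H b) = H b p * v (y b)" for b
      using vmult[OF y H] by (simp add: yp)
    \<comment> \<open>Both expansions contain the unknown term
      \<open>2 \<rho>(a) f(p) v(\<theta>)\<close>, which cancels.\<close>
    ultimately have "\<rho> a * (\<rho> a * v f) = (\<Sum>b\<in>Basis. H b p * v (y b))"
      by simp
    also have "\<dots> = \<rho> a * (\<rho> a * (\<Sum>b\<in>Basis. (v (y b) / \<rho> a) * coordinate_derivation \<A> U c b p f))"
      using \<rho>a by (simp add: Hp sum_distrib_left mult_ac)
    also have "(\<Sum>b\<in>Basis. (v (y b) / \<rho> a) * coordinate_derivation \<A> U c b p f) =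
        coordinate_derivation \<A> U c w p f"
      by (simp add: w_def sum_fun_apply linear_sum[OF linear_coordinate_derivation[OF p]]
          linear_scale[OF linear_coordinate_derivation[OF p]])
    finally show ?thesis using \<rho>a by simp
  qed (use v in \<open>simp add: coordinate_derivation_def tangent_space_def\<close>)
  then show ?thesis by blast
qed

lemma smooth_atlas_chart_ball:
  fixes \<A> :: "('m::{t2_space, second_countable_topology}, 'n::finite) atlas"
  assumes "smooth_atlas \<A>"
  obtains U c r where "(U, c) \<in> \<A>" "p \<in> U" "ball (c p) (2 * r) \<subseteq> c ` U" "r > 0"
proof -
  have "\<Union> (fst ` \<A>) = UNIV"
    using assms unfolding smooth_atlas_def by (auto simp: case_prod_beta)
  then obtain U c where U: "(U, c) \<in> \<A>" "p \<in> U" by fastforce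
  then obtain e where "e > 0" "ball (c p) e \<subseteq> c ` U"
    using smooth_atlas_chart(2)[OF assms U(1)] unfolding open_contains_ball by blast
  then show ?thesis
    using that[OF U, of "e / 2"] by simp
qed

text \<open>The cut-off coordinates separate directions: in the product rule the derivative of the
  bump is multiplied by a coordinate that vanishes at p, which leaves a nonzero multiple of
  \<open>w \<bullet> b\<close>.\<close>

lemma inj_coordinate_derivation:
  assumes atlas: "smooth_atlas \<A>" and p: "(U, c) \<in> \<A>" "p \<in> U"
    and r: "ball (c p) (2 * r) \<subseteq> c ` U" "r > 0"
  shows "inj (\<lambda>w. coordinate_derivation \<A> U c w p)"
proof -
  define y where "y b = extend_zero U c (\<lambda>x. bump (c p) r x * ((x - c p) \<bullet> b))" for b
  have y: "y b \<in> smooth_functions \<A>" for b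
    unfolding y_def
    by (rule extend_zero_smooth[OF atlas p(1) r])
      (intro smooth_on_mult smooth_on_bump smooth_on_coordinate open_ball, simp add: bump_eq_0[OF r(2)])
  have eq: "coordinate_derivation \<A> U c w p (y b) = bump (c p) r (c p) * (w \<bullet> b)" for w b
  proof (rule coordinate_derivation_eqI[OF p y])
    have c: "((\<lambda>x. (x - c p) \<bullet> b) has_derivative (\<lambda>w. w \<bullet> b)) (at (c p))"
      by (auto intro!: derivative_eq_intros)
    have \<rho>: "(bump (c p) r has_derivative frechet_derivative (bump (c p) r) (at (c p))) (at (c p))"
      by (rule smooth_on_has_derivative[OF smooth_on_bump UNIV_I])
    show "(y b \<circ> inv_into U c has_derivative (\<lambda>w. bump (c p) r (c p) * (w \<bullet> b))) (at (c p))"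
    proof (rule has_derivative_transform_within_open[OF _ smooth_atlas_chart(2)[OF atlas p(1)]])
      show "((\<lambda>x. bump (c p) r x * ((x - c p) \<bullet> b)) has_derivative
          (\<lambda>w. bump (c p) r (c p) * (w \<bullet> b))) (at (c p))"
        using has_derivative_mult[OF \<rho> c] by simp
    qed (use p in \<open>auto simp: y_def extend_zero_def smooth_atlas_inv_into[OF atlas p(1)]\<close>)
  qed
  have "bump (c p) r (c p) \<noteq> 0"
    using bump_pos[of "c p" "c p" r] r(2) by simp
  show ?thesis
  proof (rule injI)
    fix w w'
    assume "coordinate_derivation \<A> U c w p = coordinate_derivation \<A> U c w' p"
    from fun_cong[OF this] have "w \<bullet> b = w' \<bullet> b" for b
      using eq \<open>bump (c p) r (c p) \<noteq> 0\<close> by (metis mult_cancel_left)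
    then show "w = w'" by (simp add: euclidean_eq_iff[of w])
  qed
qed

text \<open>Stated for an arbitrary basis because \<open>trace_on\<close> works with a chosen one.
  It is compared in both directions with the image of the standard basis of the coordinate space.
  The first comparison also yields the finiteness that the second needs, since the ambient space of
  functionals is infinite-dimensional.\<close>

lemma tangent_space_card_basis:
  fixes \<A> :: "('m::{t2_space, second_countable_topology}, 'n::finite) atlas"
  assumes "smooth_atlas \<A>" "B \<subseteq> tangent_space \<A> p" "independent B" "tangent_space \<A> p \<subseteq> span B"
  shows "finite B \<and> card B = CARD('n)"
proof -
  obtain U c r where p: "(U, c) \<in> \<A>" "p \<in> U" and r: "ball (c p) (2 * r) \<subseteq> c ` U" "r > 0"
    using smooth_atlas_chart_ball[OF assms(1)] .
  let ?d = "\<lambda>w. coordinate_derivation \<A> U c w p"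
  let ?C = "?d ` Basis"
  have lin: "linear ?d" using linear_coordinate_derivation[OF p] .
  have inj: "inj ?d" using inj_coordinate_derivation[OF assms(1) p r] .
  have card: "card ?C = CARD('n)"
    using card_image[OF inj_on_subset[OF inj subset_UNIV]] by simp
  have ind: "independent ?C"
    using linear_independent_injective_image[OF lin independent_Basis] inj_on_subset[OF inj subset_UNIV]
    by blast
  have "?d w \<in> span ?C" for w
    using linear_span_image[OF lin, of Basis] by auto
  then have "tangent_space \<A> p \<subseteq> span ?C"
    using tangent_vector_coordinates[OF assms(1) p r] by blast
  then have 1: "finite B \<and> card B \<le> card ?C"
    using assms(2) by (intro independent_span_bound[OF _ assms(3)]) auto
  have "?C \<subseteq> span B"
    using coordinate_derivation_tangent[OF assms(1) p] assms(4) by blast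
  then have "card ?C \<le> card B"
    using independent_span_bound[of B, OF _ ind] 1 by blast
  then show ?thesis using 1 card by simp
qed

text \<open>The extension is a coordinate field with constant components, multiplied by a bump
  normalised to 1 at p.\<close>

lemma tangent_vector_extends:
  fixes \<A> :: "('m::{t2_space, second_countable_topology}, 'n::finite) atlas"
  assumes atlas: "smooth_atlas \<A>" and "v \<in> tangent_space \<A> p"
  shows "\<exists>V\<in>vector_fields \<A>. V p = v"
proof -
  obtain U c r where p: "(U, c) \<in> \<A>" "p \<in> U" and r: "ball (c p) (2 * r) \<subseteq> c ` U" "r > 0"
    using smooth_atlas_chart_ball[OF assms(1)] .
  obtain w where w: "v = coordinate_derivation \<A> U c w p"
    using tangent_vector_coordinates[OF atlas p r assms(2)] by blast
  define V where "V q = (extend_zero U c (\<lambda>x. inverse (bump (c p) r (c p)) * bump (c p) r x) q) *\<^sub>R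
    coordinate_derivation \<A> U c w q" for q
  have "V \<in> vector_fields \<A>"
    unfolding vector_fields_def mem_Collect_eq
  proof (intro conjI allI ballI)
    show "V q \<in> tangent_space \<A> q" for q
      using subspace_scale[OF subspace_tangent_space coordinate_derivation_tangent[OF atlas p(1)]]
        subspace_0[OF subspace_tangent_space]
      by (cases "q \<in> U") (auto simp: V_def extend_zero_def)
    fix f assume f: "f \<in> smooth_functions \<A>"
    let ?F = "\<lambda>x. inverse (bump (c p) r (c p)) * bump (c p) r x *
      frechet_derivative (f \<circ> inv_into U c) (at x) w"
    have "deriv_along V f = extend_zero U c ?F"
      using f by (auto simp: deriv_along_def V_def extend_zero_def coordinate_derivation_def)
    moreover have "extend_zero U c ?F \<in> smooth_functions \<A>"
    proof (rule extend_zero_smooth[OF atlas p(1) r])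
      have "smooth_on (c ` U) (f \<circ> inv_into U c)"
        using f p(1) unfolding smooth_functions_def by blast
      from smooth_on_frechet_derivative[OF smooth_on_subset[OF this r(1)], of w]
      show "smooth_on (ball (c p) (2 * r)) ?F"
        using smooth_on_mult[OF smooth_on_mult[OF smooth_on_const smooth_on_bump open_ball] _ open_ball]
        by blast
    qed (simp add: bump_eq_0[OF r(2)])
    ultimately show "deriv_along V f \<in> smooth_functions \<A>" by simp
  qed
  moreover have "V p = v"
    using p(2) bump_pos[of "c p" "c p" r] r(2) by (simp add: V_def w extend_zero_def)
  ultimately show ?thesis by blast
qed

section \<open>Traces of endomorphisms of a tangent space\<close>

text \<open>The basis is fixed before T is: traces of different maps are taken in the same basis and
  can be compared.\<close>

lemma trace_on_basis:
  obtains B where "B \<subseteq> V" "independent B" "V \<subseteq> span B"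
    "\<And>T. trace_on V T = (\<Sum>b\<in>B. representation B (T b) b)"
proof -
  let ?B = "SOME B. B \<subseteq> V \<and> independent B \<and> V \<subseteq> span B"
  have "\<exists>B. B \<subseteq> V \<and> independent B \<and> V \<subseteq> span B"
    using maximal_independent_subset[of V] by metis
  from someI_ex[OF this] show ?thesis
    using that[of ?B] unfolding trace_on_def Let_def by blast
qed

text \<open>T is a map of rank at most one minus a multiple of the identity, the shape in which the
  map from v to \<open>R'(v,Y)\<xi>\<close> will appear. The dimension enters through the trace of
  the identity.\<close>

lemma trace_on_tangent_space:
  fixes \<A> :: "('m::{t2_space, second_countable_topology}, 'n::finite) atlas"
  assumes atlas: "smooth_atlas \<A>"
    and T: "\<And>v. v \<in> tangent_space \<A> p \<Longrightarrow> T v = \<psi> v *\<^sub>R u - k *\<^sub>R v"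
    and "linear_on (tangent_space \<A> p) \<psi>" "u \<in> tangent_space \<A> p"
  shows "trace_on (tangent_space \<A> p) T = \<psi> u - k * real CARD('n)"
proof -
  let ?S = "tangent_space \<A> p"
  obtain B where B: "B \<subseteq> ?S" "independent B" "?S \<subseteq> span B"
    "\<And>T. trace_on ?S T = (\<Sum>b\<in>B. representation B (T b) b)"
    by (rule trace_on_basis) (rule that, assumption+)
  have fin: "finite B" and card: "card B = CARD('n)"
    using tangent_space_card_basis[OF atlas B(1-3)] by auto
  have u: "u = (\<Sum>b\<in>B. representation B u b *\<^sub>R b)"
    using sum_representation_eq[OF B(2) _ fin order_refl, of u] B(3) assms(4) by auto
  have sub: "subspace ?S" by (rule subspace_tangent_space)
  have \<psi>scale: "\<psi> (k *\<^sub>R v) = k * \<psi> v" if "v \<in> ?S" for k v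
    using assms(3) that unfolding linear_on_def by auto
  have "\<psi> u = \<psi> (\<Sum>b\<in>B. representation B u b *\<^sub>R b)"
    using u by metis
  also have "\<dots> = (\<Sum>b\<in>B. \<psi> (representation B u b *\<^sub>R b))"
    using B(1) by (intro linear_on_sum[OF assms(3) sub] subspace_scale[OF sub]) auto
  also have "\<dots> = (\<Sum>b\<in>B. \<psi> b * representation B u b)"
    using B(1) by (intro sum.cong refl) (auto simp: \<psi>scale)
  finally have \<psi>u: "\<psi> u = (\<Sum>b\<in>B. \<psi> b * representation B u b)" .
  have "representation B (T b) b = \<psi> b * representation B u b - k" if b: "b \<in> B" for b
  proof -
    have "u \<in> span B" "b \<in> span B"
      using B(3) assms(4) b by (auto intro: span_base)
    then have "representation B (T b) b =
        \<psi> b * representation B u b - k * representation B b b"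
      using B(1) b
      by (simp add: T subsetD representation_diff[OF B(2)] representation_scale[OF B(2)] span_scale)
    then show ?thesis
      using b by (simp add: representation_basis[OF B(2)])
  qed
  then show ?thesis
    by (simp add: B(4) \<psi>u sum_subtractf card)
qed

text \<open>T1 and T2 have to map V into itself because \<open>representation\<close> is 0 outside
  the span of the basis and is additive only inside it.\<close>

lemma trace_on_add_scale:
  assumes "\<And>v. v \<in> V \<Longrightarrow> T1 v \<in> V \<and> T2 v \<in> V" "\<And>v. v \<in> V \<Longrightarrow> T v = T1 v + k *\<^sub>R T2 v"
  shows "trace_on V T = trace_on V T1 + k * trace_on V T2"
proof -
  obtain B where B: "B \<subseteq> V" "independent B" "V \<subseteq> span B"
    and tr: "\<And>T. trace_on V T = (\<Sum>b\<in>B. representation B (T b) b)"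
    by (rule trace_on_basis) (rule that, assumption+)
  have "representation B (T b) b = representation B (T1 b) b + k * representation B (T2 b) b"
    if b: "b \<in> B" for b
  proof -
    have "T1 b \<in> span B" "T2 b \<in> span B"
      using assms(1) B(1,3) b by blast+
    then show ?thesis
      using B(1) b assms(2)
      by (simp add: subsetD representation_add[OF B(2)] representation_scale[OF B(2)] span_scale)
  qed
  then show ?thesis
    by (simp add: tr sum.distrib sum_distrib_left)
qed

section \<open>Connections and the para-Sasakian structure\<close>

lemma field_app_apply [simp]: "(T \<diamondop> X) p = T p (X p)"
  by (simp add: field_app_def)

lemma fscale_apply [simp]: "(f \<cdot> X) p = f p *\<^sub>R X p"
  by (simp add: fscale_def)

lemma deriv_along_apply [simp]: "deriv_along X f p = X p f"
  by (simp add: deriv_along_def)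

lemma linear_on_diff:
  assumes "linear_on S T" "subspace S" "u \<in> S" "v \<in> S"
  shows "T (u - v) = T u - T v"
proof -
  have "T (u - v + v) = T (u - v) + T v"
    using assms(1,4) subspace_diff[OF assms(2-4)] unfolding linear_on_def by blast
  then show ?thesis by simp
qed

lemma vector_fields_tangent: "X \<in> vector_fields \<A> \<Longrightarrow> X p \<in> tangent_space \<A> p"
  unfolding vector_fields_def by blast

lemma vector_fields_deriv_along:
  "X \<in> vector_fields \<A> \<Longrightarrow> f \<in> smooth_functions \<A> \<Longrightarrow> deriv_along X f \<in> smooth_functions \<A>"
  unfolding vector_fields_def by blast

lemma vector_fields_add:
  assumes "smooth_atlas \<A>" "X \<in> vector_fields \<A>" "Y \<in> vector_fields \<A>"
  shows "X + Y \<in> vector_fields \<A>"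
proof -
  have "deriv_along (X + Y) f = deriv_along X f + deriv_along Y f" for f
    by (simp add: fun_eq_iff)
  then show ?thesis
    using assms vector_fields_deriv_along smooth_functions_add[OF assms(1)]
    by (auto simp: vector_fields_def intro!: subspace_add[OF subspace_tangent_space])
qed

lemma vector_fields_fscale:
  assumes "smooth_atlas \<A>" "X \<in> vector_fields \<A>" "h \<in> smooth_functions \<A>"
  shows "h \<cdot> X \<in> vector_fields \<A>"
proof -
  have "deriv_along (h \<cdot> X) f = h * deriv_along X f" for f
    by (simp add: fun_eq_iff)
  then show ?thesis
    using assms vector_fields_deriv_along smooth_functions_mult[OF assms(1,3)]
    by (auto simp: vector_fields_def intro!: subspace_scale[OF subspace_tangent_space])
qed

lemma vector_fields_diff:
  assumes "smooth_atlas \<A>" "X \<in> vector_fields \<A>" "Y \<in> vector_fields \<A>"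
  shows "X - Y \<in> vector_fields \<A>"
proof -
  have "X - Y = X + (\<lambda>_. - 1) \<cdot> Y"
    by (simp add: fun_eq_iff)
  then show ?thesis
    using vector_fields_add vector_fields_fscale smooth_functions_const assms by metis
qed

section \<open>Tensoriality of the curvatures in the last argument\<close>

text \<open>The locale is meant for the quarter-symmetric connection, which has torsion in general.
  Closure under the bracket is therefore a hypothesis, discharged later through the Levi-Civita
  connection, for which the bracket is \<open>D X Y - D Y X\<close>.\<close>

locale connection =
  fixes \<A> :: "('m::{t2_space, second_countable_topology}, 'n::finite) atlas"
    and D :: "'m vfield \<Rightarrow> 'm vfield \<Rightarrow> 'm vfield"
  assumes atlas: "smooth_atlas \<A>"
    and affine: "affine_connection \<A> D"
    and bracket: "X \<in> vector_fields \<A> \<Longrightarrow> Y \<in> vector_fields \<A> \<Longrightarrow> lie_bracket X Y \<in> vector_fields \<A>"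
begin

lemma closed: "X \<in> vector_fields \<A> \<Longrightarrow> Y \<in> vector_fields \<A> \<Longrightarrow> D X Y \<in> vector_fields \<A>"
  using affine unfolding affine_connection_def by blast

lemma add:
  "X \<in> vector_fields \<A> \<Longrightarrow> Y \<in> vector_fields \<A> \<Longrightarrow> Z \<in> vector_fields \<A> \<Longrightarrow>
    D X (Y + Z) = D X Y + D X Z"
  using affine unfolding affine_connection_def by blast

lemma leibniz:
  "X \<in> vector_fields \<A> \<Longrightarrow> Y \<in> vector_fields \<A> \<Longrightarrow> f \<in> smooth_functions \<A> \<Longrightarrow>
    D X (f \<cdot> Y) = deriv_along X f \<cdot> Y + f \<cdot> D X Y"
  using affine unfolding affine_connection_def by blast

lemma curvature_closed:
  assumes "X \<in> vector_fields \<A>" "Y \<in> vector_fields \<A>" "Z \<in> vector_fields \<A>"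
  shows "curvature D X Y Z \<in> vector_fields \<A>"
  unfolding curvature_def using assms by (intro vector_fields_diff atlas closed bracket)

text \<open>Additivity and homogeneity in one identity. The terms with first derivatives of f are
  symmetric in X and Y and cancel; those with second derivatives cancel against the bracket
  term.\<close>

lemma curvature_add_fscale:
  assumes "X \<in> vector_fields \<A>" "Y \<in> vector_fields \<A>" "Z \<in> vector_fields \<A>"
    "W \<in> vector_fields \<A>" and f: "f \<in> smooth_functions \<A>"
  shows "curvature D X Y (Z + f \<cdot> W) = curvature D X Y Z + f \<cdot> curvature D X Y W"
proof -
  note vf = assms(1-4) closed vector_fields_add[OF atlas] vector_fields_fscale[OF atlas]
    vector_fields_deriv_along f bracket
  have second: "D X' (D Y' (Z + f \<cdot> W)) = D X' (D Y' Z) + (deriv_along X' (deriv_along Y' f) \<cdot> W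
      + deriv_along Y' f \<cdot> D X' W + (deriv_along X' f \<cdot> D Y' W + f \<cdot> D X' (D Y' W)))"
    if "X' \<in> vector_fields \<A>" "Y' \<in> vector_fields \<A>" for X' Y'
    using that by (simp add: add leibniz vf)
  have "D (lie_bracket X Y) (Z + f \<cdot> W) = D (lie_bracket X Y) Z +
      (deriv_along (lie_bracket X Y) f \<cdot> W + f \<cdot> D (lie_bracket X Y) W)"
    by (simp add: add leibniz vf)
  moreover have "deriv_along (lie_bracket X Y) f =
      deriv_along X (deriv_along Y f) - deriv_along Y (deriv_along X f)"
    by (simp add: fun_eq_iff lie_bracket_def)
  ultimately show ?thesis
    unfolding curvature_def second[OF assms(1,2)] second[OF assms(2,1)]
    by (simp add: fun_eq_iff algebra_simps)
qed

text \<open>\<open>ricci\<close> feeds tangent vectors to the curvature through a chosen extension;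
  this makes the choice usable.\<close>

lemma extension:
  assumes "v \<in> tangent_space \<A> p"
  shows "(SOME V. V \<in> vector_fields \<A> \<and> V p = v) \<in> vector_fields \<A>"
    and "(SOME V. V \<in> vector_fields \<A> \<and> V p = v) p = v"
proof -
  have "\<exists>V. V \<in> vector_fields \<A> \<and> V p = v"
    using tangent_vector_extends[OF atlas assms] by blast
  from someI_ex[OF this] show "(SOME V. V \<in> vector_fields \<A> \<and> V p = v) \<in> vector_fields \<A>"
    and "(SOME V. V \<in> vector_fields \<A> \<and> V p = v) p = v" by auto
qed

lemma ricci_add_fscale:
  assumes "Y \<in> vector_fields \<A>" "Z \<in> vector_fields \<A>" "W \<in> vector_fields \<A>"
    "f \<in> smooth_functions \<A>"
  shows "ricci \<A> D Y (Z + f \<cdot> W) p = ricci \<A> D Y Z p + f p * ricci \<A> D Y W p"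
  unfolding ricci_def
proof (rule trace_on_add_scale)
  fix v assume v: "v \<in> tangent_space \<A> p"
  let ?V = "SOME V. V \<in> vector_fields \<A> \<and> V p = v"
  show "curvature D ?V Y Z p \<in> tangent_space \<A> p \<and> curvature D ?V Y W p \<in> tangent_space \<A> p"
    using assms extension(1)[OF v] by (intro conjI vector_fields_tangent curvature_closed)
  show "curvature D ?V Y (Z + f \<cdot> W) p = curvature D ?V Y Z p + f p *\<^sub>R curvature D ?V Y W p"
    using curvature_add_fscale[OF extension(1)[OF v] assms] by simp
qed

lemma projective_curvature_add_fscale:
  assumes "X \<in> vector_fields \<A>" "Y \<in> vector_fields \<A>" "Z \<in> vector_fields \<A>"
    "W \<in> vector_fields \<A>" "f \<in> smooth_functions \<A>"
  shows "projective_curvature \<A> D X Y (Z + f \<cdot> W) p =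
    projective_curvature \<A> D X Y Z p + f p *\<^sub>R projective_curvature \<A> D X Y W p"
  using assms
  by (simp add: projective_curvature_def curvature_add_fscale ricci_add_fscale algebra_simps
      del: times_divide_eq_left)

end

section \<open>The quarter-symmetric connection and its curvature on \<xi>\<close>

locale para_sasakian_manifold =
  fixes \<A> :: "('m::{t2_space, second_countable_topology}, 'n::finite) atlas"
    and \<phi> :: "'m \<Rightarrow> 'm tvec \<Rightarrow> 'm tvec"
    and \<xi> :: "'m vfield"
    and \<eta> :: "'m \<Rightarrow> 'm tvec \<Rightarrow> real"
    and g :: "'m \<Rightarrow> 'm tvec \<Rightarrow> 'm tvec \<Rightarrow> real"
    and D :: "'m vfield \<Rightarrow> 'm vfield \<Rightarrow> 'm vfield"
  assumes para_sasakian: "para_sasakian \<A> \<phi> \<xi> \<eta> g D"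
begin

definition D' :: "'m vfield \<Rightarrow> 'm vfield \<Rightarrow> 'm vfield"
  where "D' = quarter_symmetric_connection \<phi> \<xi> \<eta> g D"

lemma atlas: "smooth_atlas \<A>"
  and \<xi>: "\<xi> \<in> vector_fields \<A>"
  and \<eta>_lin: "linear_on (tangent_space \<A> p) (\<eta> p)"
  and \<phi>_lin: "linear_on (tangent_space \<A> p) (\<phi> p)"
  and \<eta>_smooth: "X \<in> vector_fields \<A> \<Longrightarrow> \<eta> \<diamondop> X \<in> smooth_functions \<A>"
  and \<phi>_closed: "X \<in> vector_fields \<A> \<Longrightarrow> \<phi> \<diamondop> X \<in> vector_fields \<A>"
  and affine: "affine_connection \<A> D"
  and D_\<xi>: "X \<in> vector_fields \<A> \<Longrightarrow> D X \<xi> = \<phi> \<diamondop> X"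
  using para_sasakian
  unfolding para_sasakian_def one_form_def endomorphism_field_def levi_civita_def by auto

lemma \<eta>_\<xi>: "\<eta> p (\<xi> p) = 1"
proof -
  have "\<eta> \<diamondop> \<xi> = 1"
    using para_sasakian unfolding para_sasakian_def by blast
  from fun_cong[OF this, of p] show ?thesis by simp
qed

lemma \<eta>_\<phi>:
  assumes "X \<in> vector_fields \<A>"
  shows "\<eta> p (\<phi> p (X p)) = 0"
proof -
  have "\<eta> \<diamondop> (\<phi> \<diamondop> X) = 0"
    using para_sasakian assms unfolding para_sasakian_def by blast
  from fun_cong[OF this, of p] show ?thesis by simp
qed

lemma g_\<xi>:
  assumes "X \<in> vector_fields \<A>"
  shows "g p (X p) (\<xi> p) = \<eta> p (X p)"
proof -
  have "g \<diamondop> X \<diamondop> \<xi> = \<eta> \<diamondop> X"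
    using para_sasakian assms unfolding para_sasakian_def by blast
  from fun_cong[OF this, of p] show ?thesis by simp
qed

lemma g_lin: "u \<in> tangent_space \<A> p \<Longrightarrow> linear_on (tangent_space \<A> p) (g p u)"
  and g_sym: "u \<in> tangent_space \<A> p \<Longrightarrow> v \<in> tangent_space \<A> p \<Longrightarrow> g p u v = g p v u"
  and g_smooth: "X \<in> vector_fields \<A> \<Longrightarrow> Y \<in> vector_fields \<A> \<Longrightarrow> g \<diamondop> X \<diamondop> Y \<in> smooth_functions \<A>"
  using para_sasakian unfolding para_sasakian_def riemannian_metric_def by auto

lemma torsion_free:
  "X \<in> vector_fields \<A> \<Longrightarrow> Y \<in> vector_fields \<A> \<Longrightarrow> D X Y - D Y X = lie_bracket X Y"
  using para_sasakian unfolding para_sasakian_def levi_civita_def by blast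

lemma D_\<phi>:
  assumes "X \<in> vector_fields \<A>" "Y \<in> vector_fields \<A>"
  shows "D X (\<phi> \<diamondop> Y) p = \<phi> p (D X Y p) - g p (X p) (Y p) *\<^sub>R \<xi> p - \<eta> p (Y p) *\<^sub>R X p +
    (2 * (\<eta> p (X p) * \<eta> p (Y p))) *\<^sub>R \<xi> p"
proof -
  have "D X (\<phi> \<diamondop> Y) - \<phi> \<diamondop> D X Y =
      - ((g \<diamondop> X \<diamondop> Y) \<cdot> \<xi>) - (\<eta> \<diamondop> Y) \<cdot> X + 2 *\<^sub>R (((\<eta> \<diamondop> X) * (\<eta> \<diamondop> Y)) \<cdot> \<xi>)"
    using para_sasakian assms unfolding para_sasakian_def by blast
  from fun_cong[OF this, of p] show ?thesis
    by (simp add: algebra_simps)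
qed

lemma D'_apply: "D' X Y p = D X Y p + \<eta> p (Y p) *\<^sub>R \<phi> p (X p) - g p (\<phi> p (X p)) (Y p) *\<^sub>R \<xi> p"
  by (simp add: D'_def quarter_symmetric_connection_def)

lemma D'_affine: "affine_connection \<A> D'"
  unfolding affine_connection_def
proof (intro ballI conjI)
  fix X Y assume X: "X \<in> vector_fields \<A>" and Y: "Y \<in> vector_fields \<A>"
  note aff = affine[unfolded affine_connection_def, rule_format]
  note tan = vector_fields_tangent[OF X] vector_fields_tangent[OF Y]
    vector_fields_tangent[OF \<phi>_closed[OF X], unfolded field_app_apply]
    vector_fields_tangent[OF \<phi>_closed[OF Y], unfolded field_app_apply]
  show "D' X Y \<in> vector_fields \<A>"
    unfolding D'_def quarter_symmetric_connection_def
    using X Y aff[OF X Y]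
    by (intro vector_fields_diff vector_fields_add vector_fields_fscale atlas \<eta>_smooth \<phi>_closed
        g_smooth \<xi>) auto
  show "D' (X + Y) Z = D' X Z + D' Y Z" "D' X (Y + Z) = D' X Y + D' X Z"
    if Z: "Z \<in> vector_fields \<A>" for Z
  proof -
    note tanZ = vector_fields_tangent[OF Z]
    have DZ: "D (X + Y) Z = D X Z + D Y Z" "D X (Y + Z) = D X Y + D X Z"
      using aff[OF X Y] Z by blast+
    have "\<phi> p (X p + Y p) = \<phi> p (X p) + \<phi> p (Y p)" for p
      using \<phi>_lin tan unfolding linear_on_def by blast
    \<comment> \<open>\<open>riemannian_metric\<close> provides linearity in the second slot;
      symmetry carries it over to the first.\<close>
    moreover have "g p (u + v) (Z p) = g p u (Z p) + g p v (Z p)"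
      if "u \<in> tangent_space \<A> p" "v \<in> tangent_space \<A> p" for p u v
      using g_lin[OF tanZ[of p]] g_sym[OF tanZ[of p]] subspace_add[OF subspace_tangent_space that] that
      unfolding linear_on_def by metis
    ultimately show "D' (X + Y) Z = D' X Z + D' Y Z"
      using DZ tan by (intro ext) (simp add: D'_apply algebra_simps)
    have "\<eta> p (Y p + Z p) = \<eta> p (Y p) + \<eta> p (Z p)"
      "g p (\<phi> p (X p)) (Y p + Z p) = g p (\<phi> p (X p)) (Y p) + g p (\<phi> p (X p)) (Z p)" for p
      using \<eta>_lin g_lin tan tanZ unfolding linear_on_def by blast+
    then show "D' X (Y + Z) = D' X Y + D' X Z"
      using DZ by (intro ext) (simp add: D'_apply algebra_simps)
  qed
  show "D' (f \<cdot> X) Y = f \<cdot> D' X Y" "D' X (f \<cdot> Y) = deriv_along X f \<cdot> Y + f \<cdot> D' X Y"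
    if f: "f \<in> smooth_functions \<A>" for f
  proof -
    have Df: "D (f \<cdot> X) Y = f \<cdot> D X Y" "D X (f \<cdot> Y) = deriv_along X f \<cdot> Y + f \<cdot> D X Y"
      using aff[OF X Y] f by blast+
    have "\<phi> p (k *\<^sub>R X p) = k *\<^sub>R \<phi> p (X p)" for k p
      using \<phi>_lin tan unfolding linear_on_def by blast
    moreover have "g p (k *\<^sub>R \<phi> p (X p)) (Y p) = k * g p (\<phi> p (X p)) (Y p)" for k p
      using g_lin[OF tan(2)[of p]] g_sym[OF tan(2)[of p]] subspace_scale[OF subspace_tangent_space tan(3)] tan(3)
      unfolding linear_on_def by (metis real_scaleR_def)
    ultimately show "D' (f \<cdot> X) Y = f \<cdot> D' X Y"
      using Df by (intro ext) (simp add: D'_apply algebra_simps)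
    have "\<eta> p (k *\<^sub>R Y p) = k * \<eta> p (Y p)" "g p (\<phi> p (X p)) (k *\<^sub>R Y p) = k * g p (\<phi> p (X p)) (Y p)" for k p
      using \<eta>_lin g_lin tan unfolding linear_on_def real_scaleR_def[symmetric] by blast+
    then show "D' X (f \<cdot> Y) = deriv_along X f \<cdot> Y + f \<cdot> D' X Y"
      using Df by (intro ext) (simp add: D'_apply algebra_simps)
  qed
qed

lemma bracket_closed:
  assumes "X \<in> vector_fields \<A>" "Y \<in> vector_fields \<A>"
  shows "lie_bracket X Y \<in> vector_fields \<A>"
  unfolding torsion_free[OF assms, symmetric]
  using affine assms by (intro vector_fields_diff atlas) (auto simp: affine_connection_def)

sublocale quarter: connection \<A> D'
  by unfold_locales (use atlas D'_affine bracket_closed in auto)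

text \<open>One summand is the Levi-Civita derivative of \<xi>, the other comes from the
  \<eta>-term, and g(\<phi>X,\<xi>) = \<eta>(\<phi>X) = 0. The sum is not contracted, so that
  additivity of \<open>D'\<close> applies to it directly.\<close>

lemma D'_\<xi>: "X \<in> vector_fields \<A> \<Longrightarrow> D' X \<xi> = \<phi> \<diamondop> X + \<phi> \<diamondop> X"
  using g_\<xi>[OF \<phi>_closed] by (intro ext) (simp add: D'_apply D_\<xi> \<eta>_\<xi> \<eta>_\<phi>)

text \<open>The curvature is twice \<open>D'_X(\<phi>Y) - D'_Y(\<phi>X) - \<phi>[X,Y]\<close>. All
  multiples of \<xi> are symmetric in X and Y and cancel, the terms with \<phi> cancel by
  torsion-freeness of D, and only \<open>- \<eta>(Y) X + \<eta>(X) Y\<close> is left.\<close>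

lemma curvature_\<xi>:
  assumes X: "X \<in> vector_fields \<A>" and Y: "Y \<in> vector_fields \<A>"
  shows "curvature D' X Y \<xi> p = (2 * \<eta> p (X p)) *\<^sub>R Y p - (2 * \<eta> p (Y p)) *\<^sub>R X p"
proof -
  note \<phi>X = \<phi>_closed[OF X] and \<phi>Y = \<phi>_closed[OF Y]
  have DXY: "D X Y \<in> vector_fields \<A>" and DYX: "D Y X \<in> vector_fields \<A>"
    using affine X Y unfolding affine_connection_def by blast+
  have \<phi>_bracket: "\<phi> p (lie_bracket X Y p) = \<phi> p (D X Y p) - \<phi> p (D Y X p)"
    using linear_on_diff[OF \<phi>_lin subspace_tangent_space vector_fields_tangent[OF DXY]
        vector_fields_tangent[OF DYX], of p] by (simp flip: torsion_free[OF X Y])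
  have "g p (X p) (Y p) = g p (Y p) (X p)"
    "g p (\<phi> p (X p)) (\<phi> p (Y p)) = g p (\<phi> p (Y p)) (\<phi> p (X p))"
    using g_sym[OF vector_fields_tangent[OF X] vector_fields_tangent[OF Y]]
      g_sym[OF vector_fields_tangent[OF \<phi>X] vector_fields_tangent[OF \<phi>Y]] by auto
  then show ?thesis
    unfolding curvature_def D'_\<xi>[OF X] D'_\<xi>[OF Y] D'_\<xi>[OF bracket_closed[OF X Y]]
      quarter.add[OF X \<phi>Y \<phi>Y] quarter.add[OF Y \<phi>X \<phi>X]
    by (simp add: D'_apply D_\<phi>[OF X Y] D_\<phi>[OF Y X] \<eta>_\<phi>[OF X] \<eta>_\<phi>[OF Y] \<phi>_bracket algebra_simps
        flip: scaleR_2)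
qed

text \<open>The factor n - 1 is the difference of two traces: the rank-one part contributes 2
  \<eta>(Y), the multiple of the identity -2n \<eta>(Y).\<close>

lemma ricci_\<xi>:
  assumes Y: "Y \<in> vector_fields \<A>"
  shows "ricci \<A> D' Y \<xi> p = - 2 * (real CARD('n) - 1) * \<eta> p (Y p)"
proof -
  have "ricci \<A> D' Y \<xi> p = 2 * \<eta> p (Y p) - 2 * \<eta> p (Y p) * real CARD('n)"
    unfolding ricci_def
  proof (rule trace_on_tangent_space[OF atlas, where \<psi> = "\<lambda>v. 2 * \<eta> p v" and u = "Y p"])
    show "linear_on (tangent_space \<A> p) (\<lambda>v. 2 * \<eta> p v)"
      using \<eta>_lin[of p] unfolding linear_on_def by (simp add: algebra_simps)
  next
    fix v assume "v \<in> tangent_space \<A> p"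
    note V = quarter.extension[OF this]
    show "curvature D' (SOME V. V \<in> vector_fields \<A> \<and> V p = v) Y \<xi> p =
        (2 * \<eta> p v) *\<^sub>R Y p - (2 * \<eta> p (Y p)) *\<^sub>R v"
      using curvature_\<xi>[OF V(1) Y, of p] unfolding V(2) .
  qed (rule vector_fields_tangent[OF Y])
  then show ?thesis by (simp add: algebra_simps)
qed

text \<open>The division by n - 1 in the projective curvature undoes the factor n - 1 of the Ricci
  tensor, and what remains is exactly the curvature term.\<close>

lemma projective_curvature_\<xi>:
  assumes "CARD('n) > 1" "X \<in> vector_fields \<A>" "Y \<in> vector_fields \<A>"
  shows "projective_curvature \<A> D' X Y \<xi> = 0"
proof
  fix p
  define m where "m = real CARD('n) - 1"
  have "m \<noteq> 0" using assms(1) by (simp add: m_def)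
  then show "projective_curvature \<A> D' X Y \<xi> p = 0 p"
    using ricci_\<xi>[OF assms(2), folded m_def] ricci_\<xi>[OF assms(3), folded m_def]
      curvature_\<xi>[OF assms(2,3)]
    unfolding projective_curvature_def m_def[symmetric] by (simp add: scaleR_diff_right)
qed

lemma wedge_closed:
  assumes "X \<in> vector_fields \<A>" "Y \<in> vector_fields \<A>" "Z \<in> vector_fields \<A>"
  shows "wedge g X Y Z \<in> vector_fields \<A>"
  unfolding wedge_def using assms by (intro vector_fields_diff vector_fields_fscale atlas g_smooth)

lemma projectively_pseudosymmetric_factor:
  assumes n: "CARD('n) > 1" and pseudo: "projectively_pseudosymmetric \<A> g D' L"
    and x: "x \<in> projective_support \<A> D'"
  shows "L x = -2"
proof -
  let ?P = "projective_curvature \<A> D'"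
  \<comment> \<open>The third argument of a triple witnessing that P' is nonzero will serve as the
    second field of the pair (\<xi>,Y).\<close>
  obtain U V Y where U: "U \<in> vector_fields \<A>" and V: "V \<in> vector_fields \<A>" and Y: "Y \<in> vector_fields \<A>"
    and P: "?P U V Y x \<noteq> 0"
    using x unfolding projective_support_def by blast
  note P0 = projective_curvature_\<xi>[OF n]
  \<comment> \<open>The derivation is also applied to the value \<open>P'(U,V)\<xi>\<close>, the
    zero field. Writing that field as \<xi> + (-1) \<xi> gives 0 by tensoriality.\<close>
  have zero: "curvature D' \<xi> Y 0 x = 0"
    using fun_cong[OF quarter.curvature_add_fscale[OF \<xi> Y \<xi> \<xi> smooth_functions_const[of "-1"]], of x]
    by (simp add: plus_fun_def fscale_def zero_fun_def)
  have "\<eta> \<diamondop> Y \<in> smooth_functions \<A>" by (rule \<eta>_smooth[OF Y])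
  then have s1: "(\<lambda>p. - 2 * \<eta> p (Y p)) \<in> smooth_functions \<A>" and s2: "(\<lambda>p. \<eta> p (Y p) - 1) \<in> smooth_functions \<A>"
    using smooth_functions_mult[OF atlas smooth_functions_const[of "-2"], of "\<eta> \<diamondop> Y"]
      smooth_functions_add[OF atlas _ smooth_functions_const[of "-1"], of "\<eta> \<diamondop> Y"]
    by (simp_all add: times_fun_def plus_fun_def)
  \<comment> \<open>The following decompositions, in this odd shape, only use tensoriality of the form
    \<open>P(Z + f W) = P Z + f P W\<close>.\<close>
  have "curvature D' \<xi> Y \<xi> = (Y + (\<lambda>_. 1) \<cdot> Y) + (\<lambda>p. - 2 * \<eta> p (Y p)) \<cdot> \<xi>"
    by (intro ext) (simp add: curvature_\<xi>[OF \<xi> Y] \<eta>_\<xi>)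
  then have R: "?P U V (curvature D' \<xi> Y \<xi>) x = 2 *\<^sub>R ?P U V Y x"
    using quarter.projective_curvature_add_fscale[OF U V _ \<xi> s1]
      quarter.projective_curvature_add_fscale[OF U V Y Y smooth_functions_const[of 1]]
      vector_fields_add[OF atlas Y vector_fields_fscale[OF atlas Y smooth_functions_const[of 1]]]
    by (simp add: P0[OF U V] scaleR_2)
  have "wedge g \<xi> Y \<xi> = (\<xi> + (\<lambda>p. \<eta> p (Y p) - 1) \<cdot> \<xi>) + (\<lambda>_. - 1) \<cdot> Y"
    by (intro ext) (simp add: wedge_def g_\<xi>[OF \<xi>] g_\<xi>[OF Y] \<eta>_\<xi> algebra_simps)
  then have W: "?P U V (wedge g \<xi> Y \<xi>) x = - ?P U V Y x"
    using quarter.projective_curvature_add_fscale[OF U V _ Y smooth_functions_const[of "-1"]]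
      quarter.projective_curvature_add_fscale[OF U V \<xi> \<xi> s2]
      vector_fields_add[OF atlas \<xi> vector_fields_fscale[OF atlas \<xi> s2]]
    by (simp add: P0[OF U V])
  \<comment> \<open>The counterpart for the wedge, which is applied to the zero field as
    well.\<close>
  have g0: "g x (Z x) 0 = 0" if "Z \<in> vector_fields \<A>" for Z
    using g_lin[OF vector_fields_tangent[OF that]] subspace_0[OF subspace_tangent_space]
    unfolding linear_on_def by (metis scaleR_zero_left)
  \<comment> \<open>Three of the four terms vanish: the outer one acts on the zero field, and where
    the derivation hits U or V the last argument is still \<xi>, the new arguments being vector
    fields again.\<close>
  have "derivation_act (curvature D' \<xi> Y) ?P U V \<xi> x = - 2 *\<^sub>R ?P U V Y x"
    using quarter.curvature_closed[OF \<xi> Y] U V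
    by (simp add: derivation_act_def P0 zero R)
  moreover have "derivation_act (wedge g \<xi> Y) ?P U V \<xi> x = ?P U V Y x"
    using wedge_closed[OF \<xi> Y] U V
    by (simp add: derivation_act_def P0 W) (simp add: wedge_def g0 \<xi> Y)
  ultimately have "- 2 *\<^sub>R ?P U V Y x = L x *\<^sub>R ?P U V Y x"
    using pseudo x \<xi> Y U V unfolding projectively_pseudosymmetric_def by metis
  then show ?thesis
    using P by (metis scaleR_cancel_right)
qed

end

theorem theorem5:
  fixes \<A> :: "('m::{t2_space, second_countable_topology}, 'n::finite) atlas"
    and \<phi> :: "'m \<Rightarrow> 'm tvec \<Rightarrow> 'm tvec"
    and \<xi> :: "'m vfield"
    and \<eta> :: "'m \<Rightarrow> 'm tvec \<Rightarrow> real"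
    and g :: "'m \<Rightarrow> 'm tvec \<Rightarrow> 'm tvec \<Rightarrow> real"
    and D D' :: "'m vfield \<Rightarrow> 'm vfield \<Rightarrow> 'm vfield"
    and L :: "'m \<Rightarrow> real"
  assumes "CARD('n) > 1"
    and "para_sasakian \<A> \<phi> \<xi> \<eta> g D"
    and "D' = quarter_symmetric_connection \<phi> \<xi> \<eta> g D"
    and "projectively_pseudosymmetric \<A> g D' L"
  shows "einstein \<A> g D' \<or> (\<forall>x\<in>projective_support \<A> D'. L x = -2)"
proof -
  interpret para_sasakian_manifold \<A> \<phi> \<xi> \<eta> g D
    using assms(2) by unfold_locales
  show ?thesis
    using projectively_pseudosymmetric_factor[OF assms(1)] assms(4)
    unfolding assms(3) D'_def by blast
qed

end
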